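(* Let $\{P_n\}_{n\ge0}$ be an $N\times N$ sequence of matrix-valued orthogonal polynomials (with respect to some weight matrix $W$), and for $j=1,\dots,N$ let $\{p_{j,n}\}_{n\ge0}$ be a scalar-valued sequence of orthogonal polynomials (with respect to some scalar weight $w_j$). Then $\{P_n\}$ is a Darboux transformation of $\{p_{1,n}\oplus\cdots\oplus p_{N,n}\}$ if and only if for each $j=1,\dots,N$ there exists a $1\times N$ vector-valued linear differential operator $D_j$ such that $$\Lambda_n(D_j)\,P_n=p_{j,n}\cdot D_j\quad\text{for all } n\ge0,$$ for some $1\times N$ vectors $\Lambda_n(D_j)\in\mathbb{C}^{1\times N}$, and the vectors $\{\Lambda_n(D_1),\dots,\Lambda_n(D_N)\}$ are linearly independent for some $n$.
   Context: Fix a possibly infinite interval $(x_0,x_1)$ of the real line. A weight matrix of size $N$ is a complex $N\times N$ matrix-valued smooth function $W$ on $(x_0,x_1)$ that is positive definite almost everywhere and has finite moments of all orders; a scalar weight is a weight matrix of size $1$. For $P,Q\in\operatorname{Mat}_N(\mathbb{C}[x])$ put $\langle P,Q\rangle_W=\int_{x_0}^{x_1}P(x)W(x)Q(x)^*\,dx$, where $*$ is the Hermitian conjugate. A sequence of matrix-valued orthogonal polynomials with respect to $W$ is a sequence $\{P_n\}_{n\in\mathbb{N}_0}$ in $\operatorname{Mat}_N(\mathbb{C}[x])$, $\mathbb{N}_0=\{0,1,\dots\}$, with $P_n$ of degree $n$ with nonsingular leading coefficient and $\langle P_n,P_m\rangle_W=0$ for $n\ne m$. The direct sum $F_1\oplus\cdots\oplus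 F_r$ is the block diagonal matrix with blocks $F_1,\dots,F_r$. Differential operators $D=\sum_{i=0}^s\partial^iF_i(x)$, $\partial=\frac{d}{dx}$, act on the right: $(P\cdot D)(x)=\sum_{i=0}^s\frac{d^iP}{dx^i}(x)F_i(x)$, and $P\cdot(DE)=(P\cdot D)\cdot E$. All differential operators (square or rectangular) have coefficients $F_i$ with entries in $\mathbb{C}[x]$. $\operatorname{Mat}_N(\Omega[x])$ is the algebra of $N\times N$ such operators. $\mathcal{D}(W)$ is the set of $D\in\operatorname{Mat}_N(\Omega[x])$ such that, for every $n\in\mathbb{N}_0$, $P_n\cdot D=\Lambda_n(D)P_n$ for some $\Lambda_n(D)\in\operatorname{Mat}_N(\mathbb{C})$ (this does not depend on the chosen orthogonal sequence $\{P_n\}$ for $W$). An operator $E\in\operatorname{Mat}_N(\Omega[x])$ is degree-preserving if, for all but finitely many $n\in\mathbb{N}_0$, for any (matrix) polynomial $f$ of degree $n$ the function $f\cdot E$ is again a polynomial of degree $n$. For sequences $\{P_n\},\{\tilde P_n\}$ of $N\times N$ matrix-valued orthogonal polynomials with respect to $W,\tilde W$, $\{\tilde P_n\}$ is a Darboux transformation of $\{P_n\}$ if there is $D\in\mathcal{D}(W)$ that can be factorized as $D=\mathcal{V}\mathcal{N}$ with degree-preserving $\mathcal{V},\mathcal{N}\in\operatorname{Mat}_N(\Omega[x])$ such that $P_n\cdot\mathcal{V}=A_n\tilde P_n$ for all $n\in\mathbb{N}_0$, for some $A_n\in\operatorname{Mat}_N(\mathbb{C})$. For $D=\sum_j\partial^jF_j$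 let $D^*=\sum_jF_j(x)^*(-1)^j\partial^j$ be the formal adjoint; thus $Q\cdot(WD^*W^{-1})=\sum_j(-1)^j\frac{d^j}{dx^j}(QWF_j^* )W^{-1}$. Standing assumption on weights: all weight matrices considered (including direct sums of the weights considered) are "good enough" in the following sense, written for a weight $W$ of size $N$: if $D\in\operatorname{Mat}_N(\Omega[x])$ and $A\in\operatorname{Mat}_N(\mathbb{C}[x])$ satisfy $\int_{x_0}^{x_1}PAW\,dx=\int_{x_0}^{x_1}P\,(W\cdot D)\,dx$ for all $P\in\operatorname{Mat}_N(\mathbb{C}[x])$, then $AW=W\cdot D$. In particular, whenever $D,\tilde D\in\operatorname{Mat}_N(\Omega[x])$ satisfy $\langle P\cdot D,Q\rangle_W=\langle P,Q\cdot\tilde D\rangle_W$ for all $P,Q\in\operatorname{Mat}_N(\mathbb{C}[x])$, one has $\tilde D=WD^*W^{-1}$. *)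

theory Defs
  imports "HOL-Analysis.Analysis" "HOL-Computational_Algebra.Polynomial"
begin

section \<open>Matrix polynomials\<close>

text \<open>An \<open>m \<times> n\<close> matrix over \<open>\<complex>[x]\<close> is an element of \<open>complex poly ^ 'n ^ 'm\<close>; scalars are
  \<open>1 \<times> 1\<close> matrices and row vectors are \<open>1 \<times> n\<close> matrices, via the numeral type \<open>1\<close>.\<close>

type_synonym ('m, 'n) mpoly = "complex poly ^ 'n ^ 'm"

definition mdegree :: "('m::finite, 'n::finite) mpoly \<Rightarrow> nat" where
  "mdegree P = Max (range (\<lambda>(i, j). degree (P $ i $ j)))"

definition mcoeff :: "('m::finite, 'n::finite) mpoly \<Rightarrow> nat \<Rightarrow> complex ^ 'n ^ 'm" where
  "mcoeff P k = (\<chi> i j. coeff (P $ i $ j) k)"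

definition meval :: "('m::finite, 'n::finite) mpoly \<Rightarrow> real \<Rightarrow> complex ^ 'n ^ 'm" where
  "meval P x = (\<chi> i j. poly (P $ i $ j) (of_real x))"

definition mconst :: "complex ^ 'n ^ 'm \<Rightarrow> ('m::finite, 'n::finite) mpoly" where
  "mconst A = (\<chi> i j. [:A $ i $ j:])"

definition mderiv :: "('m::finite, 'n::finite) mpoly \<Rightarrow> ('m, 'n) mpoly" where
  "mderiv P = (\<chi> i j. pderiv (P $ i $ j))"

section \<open>Differential operators acting on the right\<close>

text \<open>The operator \<open>\<Sum>i. \<partial>\<^sup>i F\<^sub>i\<close> is encoded by the finitely supported sequence of its coefficients
  \<open>F\<^sub>i = coeff D i\<close>. The type of polynomials serves only as a type of such sequences, with its
  additive structure: its product is unrelated to the product of operators, which is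
  \<open>op_mult\<close>.\<close>

type_synonym ('m, 'n) diffop = "('m, 'n) mpoly poly"

definition act :: "('l::finite, 'm::finite) mpoly \<Rightarrow> ('m, 'n::finite) diffop \<Rightarrow> ('l, 'n) mpoly" where
  "act P D = (\<Sum>i\<le>degree D. (mderiv ^^ i) P ** coeff D i)"

text \<open>By the Leibniz rule,
  \<open>\<partial>\<^sup>i F \<partial>\<^sup>j G = \<Sum>k\<le>j. (j choose k) \<partial>\<^bsup>i+k\<^esup> F\<^bsup>(j-k)\<^esup> G\<close>; see \<open>act_op_mult\<close> below.\<close>

definition op_mult ::
  "('l::finite, 'm::finite) diffop \<Rightarrow> ('m, 'n::finite) diffop \<Rightarrow> ('l, 'n) diffop" where
  "op_mult D E = (\<Sum>i\<le>degree D. \<Sum>j\<le>degree E. \<Sum>k\<le>j.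
     monom (mat (of_nat (j choose k)) ** ((mderiv ^^ (j - k)) (coeff D i) ** coeff E j)) (i + k))"

lemma mderiv_pow_0 [simp]: "(mderiv ^^ i) 0 = 0"
  by (induction i) (auto simp: mderiv_def vec_eq_iff)

lemma mderiv_add: "mderiv (P + Q) = mderiv P + mderiv Q"
  by (simp add: mderiv_def vec_eq_iff pderiv_add)

lemma mderiv_pow_sum: "(mderiv ^^ k) (\<Sum>i\<in>A. f i) = (\<Sum>i\<in>A. (mderiv ^^ k) (f i))"
proof -
  have a: "(mderiv ^^ k) (P + Q) = (mderiv ^^ k) P + (mderiv ^^ k) Q"
    for P Q :: "('m::finite, 'n::finite) mpoly"
    by (induction k) (simp_all add: mderiv_add)
  show ?thesis
    by (induction A rule: infinite_finite_induct) (simp_all add: a)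
qed

lemma matrix_mul_0 [simp]:
  fixes A :: "'a::semiring_1 ^ 'm::finite ^ 'l::finite"
  shows "A ** (0 :: 'a ^ 'n ^ 'm) = 0" and "(0 :: 'a ^ 'l ^ 'k) ** A = 0"
  by (simp_all add: matrix_matrix_mult_def vec_eq_iff)

lemma matrix_mul_sum:
  fixes A :: "'a::semiring_1 ^ 'm::finite ^ 'l::finite"
  shows "A ** (\<Sum>s\<in>S. f s :: 'a ^ 'n ^ 'm) = (\<Sum>s\<in>S. A ** f s)"
    and "(\<Sum>s\<in>S. g s :: 'a ^ 'l ^ 'k) ** A = (\<Sum>s\<in>S. g s ** A)"
proof -
  have "(B + C) ** A = B ** A + C ** A" for B C :: "'a ^ 'l ^ 'k"
    by (simp add: matrix_matrix_mult_def vec_eq_iff distrib_right sum.distrib)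
  then show "(\<Sum>s\<in>S. g s) ** A = (\<Sum>s\<in>S. g s ** A)"
    by (induction S rule: infinite_finite_induct) simp_all
  show "A ** (\<Sum>s\<in>S. f s) = (\<Sum>s\<in>S. A ** f s)"
    by (induction S rule: infinite_finite_induct) (simp_all add: matrix_add_ldistrib)
qed

lemma act_ge:
  assumes "degree D \<le> d"
  shows "act P D = (\<Sum>i\<le>d. (mderiv ^^ i) P ** coeff D i)"
  unfolding act_def by (rule sum.mono_neutral_left) (use assms in \<open>auto simp: coeff_eq_0\<close>)

lemma act_add: "act P (D + E) = act P D + act P E"
proof -
  define d where "d = max (degree D) (degree E)"
  have "degree (D + E) \<le> d" "degree D \<le> d" "degree E \<le> d"
    using degree_add_le_max[of D E] by (auto simp: d_def)
  then show ?thesis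
    by (simp add: act_ge matrix_add_ldistrib sum.distrib)
qed

lemma act_sum: "act P (\<Sum>i\<in>A. D i) = (\<Sum>i\<in>A. act P (D i))"
  by (induction A rule: infinite_finite_induct) (simp_all add: act_add, simp_all add: act_def)

lemma act_monom: "act P (monom F i) = (mderiv ^^ i) P ** F"
proof -
  have "act P (monom F i) = (\<Sum>k\<le>i. (mderiv ^^ k) P ** coeff (monom F i) k)"
    by (rule act_ge) (rule degree_monom_le)
  also have "\<dots> = (\<Sum>k\<le>i. if k = i then (mderiv ^^ i) P ** F else 0)"
    by (rule sum.cong) auto
  finally show ?thesis by simp
qed

lemma mderiv_mult: "mderiv (P ** Q) = mderiv P ** Q + P ** mderiv Q"
proof -
  have "pderiv (\<Sum>k\<in>UNIV. P $ i $ k * Q $ k $ j) =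
      (\<Sum>k\<in>UNIV. pderiv (P $ i $ k) * Q $ k $ j) + (\<Sum>k\<in>UNIV. P $ i $ k * pderiv (Q $ k $ j))"
    for i j
    using higher_pderiv_sum[of 1 "\<lambda>k. P $ i $ k * Q $ k $ j" UNIV]
    by (simp add: pderiv_mult sum.distrib add.commute mult.commute)
  then show ?thesis
    by (simp add: mderiv_def matrix_matrix_mult_def vec_eq_iff)
qed

lemma mat_of_nat_comm:
  fixes A :: "('m::finite, 'n::finite) mpoly"
  shows "A ** mat (of_nat c) = mat (of_nat c) ** A"
  by (simp add: matrix_matrix_mult_def mat_def vec_eq_iff if_distrib if_distribR
      sum.delta sum.delta' mult.commute cong: if_cong)

lemma mat_of_nat_mult: "(mat (of_nat c) ** A) $ i $ j = of_nat c * (A :: ('m::finite, 'n::finite) mpoly) $ i $ j"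
  by (simp add: matrix_matrix_mult_def mat_def if_distrib if_distribR
      sum.delta sum.delta' cong: if_cong)

lemma mderiv_of_nat: "mderiv (mat (of_nat c) ** A) = mat (of_nat c) ** mderiv A"
  by (simp add: vec_eq_iff mderiv_def mat_of_nat_mult pderiv_mult)

lemma mderiv_pow_mult:
  fixes P :: "('l::finite, 'm::finite) mpoly" and Q :: "('m, 'n::finite) mpoly"
  shows "(mderiv ^^ j) (P ** Q) =
    (\<Sum>k\<le>j. mat (of_nat (j choose k)) ** ((mderiv ^^ k) P ** (mderiv ^^ (j - k)) Q))"
proof (induction j)
  case (Suc j)
  define f where "f k l = (mderiv ^^ k) P ** (mderiv ^^ l) Q" for k l
  have f': "mderiv (f k l) = f (Suc k) l + f k (Suc l)" for k l
    by (simp add: f_def mderiv_mult)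
  have nat_add: "mat (of_nat (a + b)) ** A = mat (of_nat a) ** A + mat (of_nat b) ** A"
    for a b and A :: "('l, 'n) mpoly"
    by (simp only: vec_eq_iff mat_of_nat_mult vector_add_component) (simp add: distrib_right)
  have "(mderiv ^^ Suc j) (P ** Q) = (mderiv ^^ 1) (\<Sum>k\<le>j. mat (of_nat (j choose k)) ** f k (j - k))"
    using Suc by (simp add: f_def)
  also have "\<dots> = (\<Sum>k\<le>j. mat (of_nat (j choose k)) ** f (Suc k) (j - k))
      + (\<Sum>k\<le>j. mat (of_nat (j choose k)) ** f k (Suc j - k))"
    unfolding mderiv_pow_sum
    by (simp add: mderiv_of_nat f' matrix_add_ldistrib sum.distrib Suc_diff_le)
  also have "(\<Sum>k\<le>j. mat (of_nat (j choose k)) ** f k (Suc j - k))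
      = (\<Sum>k\<le>Suc j. mat (of_nat (j choose k)) ** f k (Suc j - k))"
    by (simp add: vec_eq_iff mat_of_nat_mult)
  also have "\<dots> = f 0 (Suc j) + (\<Sum>k\<le>j. mat (of_nat (j choose Suc k)) ** f (Suc k) (j - k))"
    by (subst sum.atMost_Suc_shift) (simp add: vec_eq_iff mat_of_nat_mult)
  also have "(\<Sum>k\<le>j. mat (of_nat (j choose k)) ** f (Suc k) (j - k)) + \<dots>
      = f 0 (Suc j) + (\<Sum>k\<le>j. mat (of_nat (Suc j choose Suc k)) ** f (Suc k) (j - k))"
    unfolding binomial_Suc_Suc nat_add sum.distrib by (simp add: algebra_simps)
  also have "\<dots> = (\<Sum>k\<le>Suc j. mat (of_nat (Suc j choose k)) ** f k (Suc j - k))"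
    by (subst sum.atMost_Suc_shift) (simp add: vec_eq_iff mat_of_nat_mult)
  finally show ?case by (simp add: f_def)
qed (simp add: vec_eq_iff mat_of_nat_mult)

lemma act_op_mult:
  fixes P :: "('k::finite, 'b::finite) mpoly"
    and D :: "('b, 'c::finite) diffop" and E :: "('c, 'd::finite) diffop"
  shows "act P (op_mult D E) = act (act P D) E"
proof -
  have *: "(mderiv ^^ i) P ** (mat (of_nat c) ** A) = mat (of_nat c) ** ((mderiv ^^ i) P ** A)"
    for i c and A :: "('b, 'd::finite) mpoly"
    by (metis mat_of_nat_comm matrix_mul_assoc)
  have comp: "(mderiv ^^ (i + k)) P = (mderiv ^^ k) ((mderiv ^^ i) P)" for i k
    by (metis add.commute comp_apply funpow_add)
  have "act P (op_mult D E) = (\<Sum>i\<le>degree D. \<Sum>j\<le>degree E. \<Sum>k\<le>j.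
      mat (of_nat (j choose k)) ** ((mderiv ^^ k) ((mderiv ^^ i) P) **
        (mderiv ^^ (j - k)) (coeff D i)) ** coeff E j)"
    unfolding op_mult_def act_sum act_monom *
    by (simp add: matrix_mul_assoc comp)
  also have "\<dots> = (\<Sum>i\<le>degree D. \<Sum>j\<le>degree E.
      (mderiv ^^ j) ((mderiv ^^ i) P ** coeff D i) ** coeff E j)"
    by (simp add: mderiv_pow_mult matrix_mul_sum)
  also have "\<dots> = act (act P D) E"
    unfolding act_def mderiv_pow_sum matrix_mul_sum by (rule sum.swap)
  finally show ?thesis .
qed

text \<open>The zero matrix has \<open>mdegree\<close> \<open>0\<close>, but this only affects the single index \<open>n = 0\<close>.\<close>

definition degree_preserving :: "('n::finite, 'n) diffop \<Rightarrow> bool" where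
  "degree_preserving E \<longleftrightarrow>
     (\<forall>\<^sub>\<infinity>n. \<forall>f :: ('n, 'n) mpoly. mdegree f = n \<longrightarrow> mdegree (act f E) = n)"

section \<open>Weight matrices on the interval from \<open>a\<close> to \<open>b\<close>\<close>

definition hconj :: "complex ^ 'n ^ 'm \<Rightarrow> complex ^ 'm ^ 'n" where
  "hconj A = (\<chi> i j. cnj (A $ j $ i))"

definition pos_definite :: "complex ^ 'n ^ 'n::finite \<Rightarrow> bool" where
  "pos_definite A \<longleftrightarrow> hconj A = A \<and>
     (\<forall>v. v \<noteq> 0 \<longrightarrow> Re (\<Sum>i\<in>UNIV. \<Sum>j\<in>UNIV. cnj (v $ i) * A $ i $ j * v $ j) > 0)"

definition vderiv :: "nat \<Rightarrow> (real \<Rightarrow> 'a::real_normed_vector) \<Rightarrow> real \<Rightarrow> 'a" where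
  "vderiv k = (\<lambda>f x. vector_derivative f (at x)) ^^ k"

definition weight_matrix :: "ereal \<Rightarrow> ereal \<Rightarrow> (real \<Rightarrow> complex ^ 'n ^ 'n::finite) \<Rightarrow> bool" where
  "weight_matrix a b W \<longleftrightarrow>
     (\<forall>k. \<forall>x\<in>einterval a b. vderiv k W differentiable at x) \<and>
     (AE x in lborel. x \<in> einterval a b \<longrightarrow> pos_definite (W x)) \<and>
     (\<forall>k. set_integrable lborel (einterval a b) (\<lambda>x. x ^ k *\<^sub>R W x))"

definition winner :: "ereal \<Rightarrow> ereal \<Rightarrow> (real \<Rightarrow> complex ^ 'n ^ 'n::finite)
    \<Rightarrow> ('n, 'n) mpoly \<Rightarrow> ('n, 'n) mpoly \<Rightarrow> complex ^ 'n ^ 'n" where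
  "winner a b W P Q = (LBINT x:einterval a b. meval P x ** W x ** hconj (meval Q x))"

definition orthogonal_polys :: "ereal \<Rightarrow> ereal \<Rightarrow> (real \<Rightarrow> complex ^ 'n ^ 'n::finite)
    \<Rightarrow> (nat \<Rightarrow> ('n, 'n) mpoly) \<Rightarrow> bool" where
  "orthogonal_polys a b W P \<longleftrightarrow>
     (\<forall>n. mdegree (P n) = n \<and> invertible (mcoeff (P n) n)) \<and>
     (\<forall>n m. n \<noteq> m \<longrightarrow> winner a b W (P n) (P m) = 0)"

text \<open>\<open>W \<cdot> D = \<Sum>i. W\<^bsup>(i)\<^esup> F\<^sub>i\<close>\<close>

definition wact :: "(real \<Rightarrow> complex ^ 'n ^ 'n::finite) \<Rightarrow> ('n, 'n) diffop
    \<Rightarrow> real \<Rightarrow> complex ^ 'n ^ 'n" where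
  "wact W D x = (\<Sum>i\<le>degree D. vderiv i W x ** meval (coeff D i) x)"

text \<open>An identity between integrals presupposes that both exist. The moments of a weight matrix are
  finite, so this only has to be required for the right-hand side; without it, a divergent integral
  would have the default value \<open>0\<close>.\<close>

definition good_enough :: "ereal \<Rightarrow> ereal \<Rightarrow> (real \<Rightarrow> complex ^ 'n ^ 'n::finite) \<Rightarrow> bool" where
  "good_enough a b W \<longleftrightarrow> (\<forall>(D :: ('n, 'n) diffop) (A :: ('n, 'n) mpoly).
     (\<forall>P :: ('n, 'n) mpoly.
        set_integrable lborel (einterval a b) (\<lambda>x. meval P x ** wact W D x) \<and>
        (LBINT x:einterval a b. meval P x ** meval A x ** W x) =
        (LBINT x:einterval a b. meval P x ** wact W D x))
     \<longrightarrow> (\<forall>x\<in>einterval a b. meval A x ** W x = wact W D x))"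

text \<open>The algebra \<open>\<D>(W)\<close>. Its defining condition does not depend on the choice of the orthogonal
  sequence \<open>P\<close> for \<open>W\<close>.\<close>

definition diffop_algebra :: "ereal \<Rightarrow> ereal \<Rightarrow> (real \<Rightarrow> complex ^ 'n ^ 'n::finite)
    \<Rightarrow> ('n, 'n) diffop set" where
  "diffop_algebra a b W = {D. \<exists>P. orthogonal_polys a b W P \<and>
     (\<forall>n. \<exists>\<Lambda> :: complex ^ 'n ^ 'n. act (P n) D = mconst \<Lambda> ** P n)}"

text \<open>\<open>P'\<close> is a Darboux transformation of \<open>P\<close>, where \<open>P\<close> is orthogonal with respect to \<open>W\<close>
  and \<open>P'\<close> with respect to \<open>W'\<close>.\<close>

definition darboux_transformation :: "ereal \<Rightarrow> ereal
    \<Rightarrow> (real \<Rightarrow> complex ^ 'n ^ 'n::finite) \<Rightarrow> (nat \<Rightarrow> ('n, 'n) mpoly)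
    \<Rightarrow> (real \<Rightarrow> complex ^ 'n ^ 'n) \<Rightarrow> (nat \<Rightarrow> ('n, 'n) mpoly) \<Rightarrow> bool" where
  "darboux_transformation a b W P W' P' \<longleftrightarrow>
     orthogonal_polys a b W P \<and> orthogonal_polys a b W' P' \<and>
     (\<exists>D\<in>diffop_algebra a b W. \<exists>V N :: ('n, 'n) diffop.
        D = op_mult V N \<and> degree_preserving V \<and> degree_preserving N \<and>
        (\<exists>A :: nat \<Rightarrow> complex ^ 'n ^ 'n. \<forall>n. act (P n) V = mconst (A n) ** P' n))"

section \<open>Direct sums\<close>

text \<open>\<open>scalar_dsum F\<close> is the direct sum of the \<open>1 \<times> 1\<close> matrices \<open>F j\<close>, and \<open>block_dsum A B = A \<oplus> B\<close>.\<close>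

definition scalar_dsum :: "('n::finite \<Rightarrow> 'a::zero ^ 1 ^ 1) \<Rightarrow> 'a ^ 'n ^ 'n" where
  "scalar_dsum F = (\<chi> i j. if i = j then F i $ 1 $ 1 else 0)"

definition block_dsum :: "'a::zero ^ 'm::finite ^ 'm \<Rightarrow> 'a ^ 'n::finite ^ 'n \<Rightarrow> 'a ^ ('m + 'n) ^ ('m + 'n)" where
  "block_dsum A B = (\<chi> i j. case (i, j) of
     (Inl k, Inl l) \<Rightarrow> A $ k $ l | (Inr k, Inr l) \<Rightarrow> B $ k $ l | _ \<Rightarrow> 0)"

end

(* Right multiplication by a differential operator is exactly a left-linear map T of matrix
   polynomials for which iterated commutators with multiplication by x vanish eventually. Since x is
   symmetric for the inner products, this condition passes to formal adjoints: if the operator V maps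
   p_n to A_n P_n, then its adjoint, given by
     P_n |-> <P_n,P_n> A_n^* <p_n,p_n>^{-1} p_n,
   is again a differential operator N, and V N belongs to the algebra of the weight of p. The matrix
   A_n is, up to the leading coefficients of p_n and P_n, a polynomial in n, so if it is invertible
   once then it is so for almost all n, which makes V and N degree-preserving. Conversely, a
   degree-preserving V cannot have A_n singular for large n. The rows of V are the operators D_j. *)
theory Submission imports Defs begin

section \<open>Coefficient matrices and degrees of matrix polynomials\<close>

lemma mat_mult_entry:
  "(mat c ** A) $ i $ j = c * (A :: 'a::semiring_1 ^ 'n ^ 'm::finite) $ i $ j"
  by (simp add: matrix_matrix_mult_def mat_def if_distrib if_distribR sum.delta sum.delta' cong: if_cong)

lemma matrix_add_rdistrib: "(B + C) ** A = B ** A + C ** (A :: 'a::semiring_1 ^ 'n ^ 'm::finite)"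
  by (simp add: vec_eq_iff matrix_matrix_mult_def distrib_right sum.distrib)

lemma matrix_diff_ldistrib: "A ** (B - C) = A ** B - A ** (C :: 'a::ring_1 ^ 'n ^ 'm::finite)"
  by (simp add: vec_eq_iff matrix_matrix_mult_def right_diff_distrib sum_subtractf)

lemma mcoeff_0 [simp]: "mcoeff 0 k = 0"
  by (simp add: mcoeff_def vec_eq_iff)

lemma mcoeff_add: "mcoeff (P + Q) k = mcoeff P k + mcoeff Q k"
  by (simp add: mcoeff_def vec_eq_iff)

lemma mcoeff_diff: "mcoeff (P - Q) k = mcoeff P k - mcoeff Q k"
  by (simp add: mcoeff_def vec_eq_iff)

lemma mcoeff_sum: "mcoeff (\<Sum>i\<in>I. P i) k = (\<Sum>i\<in>I. mcoeff (P i) k)"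
  by (induction I rule: infinite_finite_induct) (simp_all add: mcoeff_add)

lemma mcoeff_mconst_mult [simp]:
  fixes A :: "complex ^ 'm::finite ^ 'l::finite"
  shows "mcoeff (mconst A ** P) k = A ** mcoeff P k"
  by (simp add: mcoeff_def mconst_def vec_eq_iff matrix_matrix_mult_def coeff_sum)

lemma mpoly_eqI: "(\<And>k. mcoeff P k = mcoeff Q k) \<Longrightarrow> P = Q"
  by (simp add: mcoeff_def vec_eq_iff poly_eq_iff)

text \<open>Trades the maximum over the entries for a condition on coefficient matrices, which
  passes through sums and constant left factors.\<close>

lemma mdegree_le_iff: "mdegree P \<le> n \<longleftrightarrow> (\<forall>k>n. mcoeff P k = 0)"
proof -
  have "mdegree P \<le> n \<longleftrightarrow> (\<forall>i j. degree (P $ i $ j) \<le> n)"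
    by (auto simp: mdegree_def)
  also have "\<dots> \<longleftrightarrow> (\<forall>k>n. mcoeff P k = 0)"
  proof safe
    fix k assume "\<forall>i j. degree (P $ i $ j) \<le> n" "n < k"
    then show "mcoeff P k = 0"
      by (simp add: mcoeff_def vec_eq_iff) (meson coeff_eq_0 le_less_trans)
  next
    fix i j assume "\<forall>k>n. mcoeff P k = 0"
    then show "degree (P $ i $ j) \<le> n"
      by (intro degree_le) (simp add: mcoeff_def vec_eq_iff)
  qed
  finally show ?thesis .
qed

lemma mcoeff_eq_0: "mdegree P < k \<Longrightarrow> mcoeff P k = 0"
  using mdegree_le_iff by blast

lemma mdegree_eqI: "mdegree P \<le> n \<Longrightarrow> mcoeff P n \<noteq> 0 \<Longrightarrow> mdegree P = n"
  by (meson le_neq_implies_less mcoeff_eq_0)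

text \<open>Degree 0 is excluded because the zero matrix also has \<open>mdegree\<close> 0.\<close>

lemma mcoeff_mdegree:
  assumes "mdegree P = n" "n > 0"
  shows "mcoeff P n \<noteq> 0"
proof
  assume "mcoeff P n = 0"
  moreover have "k = n \<or> n < k" if "n - 1 < k" for k
    using that by linarith
  ultimately have "mdegree P \<le> n - 1"
    unfolding mdegree_le_iff using assms(1) mcoeff_eq_0[of P] by blast
  with assms show False by simp
qed

lemma mconst_mult:
  fixes A :: "complex ^ 'm::finite ^ 'l::finite"
  shows "mconst (A ** B) ** (P :: ('n::finite, 'k::finite) mpoly) = mconst A ** (mconst B ** P)"
  by (rule mpoly_eqI) (simp add: matrix_mul_assoc[symmetric])

lemma mconst_add_mult:
  fixes A :: "complex ^ 'm::finite ^ 'l::finite"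
  shows "mconst (A + B) ** (P :: ('m, 'n::finite) mpoly) = mconst A ** P + mconst B ** P"
  by (rule mpoly_eqI) (simp add: mcoeff_add matrix_add_rdistrib)

lemma mconst_0_mult [simp]:
  "mconst (0 :: complex ^ 'm::finite ^ 'l::finite) ** (P :: ('m, 'n::finite) mpoly) = 0"
  by (rule mpoly_eqI) simp

section \<open>Differential operators and commutation with the variable\<close>

definition xmul :: "('m::finite, 'n::finite) mpoly \<Rightarrow> ('m, 'n) mpoly" where
  "xmul P = (\<chi> i j. pCons 0 (P $ i $ j))"

lemma xmul_add: "xmul (P + Q) = xmul P + xmul Q"
  by (simp add: xmul_def vec_eq_iff)

lemma xmul_0 [simp]: "xmul 0 = 0"
  by (simp add: xmul_def vec_eq_iff)

lemma xmul_diff: "xmul (P - Q) = xmul P - xmul Q"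
  by (simp add: xmul_def vec_eq_iff)

lemma xmul_sum: "xmul (\<Sum>i\<in>I. P i) = (\<Sum>i\<in>I. xmul (P i))"
  by (induction I rule: infinite_finite_induct) (simp_all add: xmul_add)

lemma pCons_0_sum: "pCons 0 (\<Sum>i\<in>I. f i) = (\<Sum>i\<in>I. pCons 0 (f i))"
proof (induction I rule: infinite_finite_induct)
  case (insert i I)
  then show ?case by (simp flip: insert.IH)
qed simp_all

lemma xmul_mult_left: "xmul (P ** Q) = xmul P ** Q"
  by (simp add: xmul_def vec_eq_iff matrix_matrix_mult_def pCons_0_sum)

lemma xmul_mult_right: "xmul (P ** Q) = P ** xmul Q"
  by (simp add: xmul_def vec_eq_iff matrix_matrix_mult_def pCons_0_sum)

lemma mderiv_xmul: "mderiv (xmul P) = P + xmul (mderiv P)"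
  by (simp add: xmul_def mderiv_def vec_eq_iff pderiv_pCons)

text \<open>The Leibniz rule for a factor x. The exponent is a successor so that the lowered order
  \<open>i\<close> needs no truncated subtraction.\<close>

lemma mderiv_pow_Suc_xmul:
  "(mderiv ^^ Suc i) (xmul P) = xmul ((mderiv ^^ Suc i) P) + mat (of_nat (Suc i)) ** (mderiv ^^ i) P"
proof (induction i)
  case 0
  show ?case by (simp add: mderiv_xmul)
next
  case (Suc i)
  have "(mderiv ^^ Suc (Suc i)) (xmul P) =
      mderiv (xmul ((mderiv ^^ Suc i) P) + mat (of_nat (Suc i)) ** (mderiv ^^ i) P)"
    by (simp only: funpow.simps(2)[of "Suc i"] comp_apply Suc)
  also have "\<dots> = xmul ((mderiv ^^ Suc (Suc i)) P) + mat (of_nat (Suc (Suc i))) ** (mderiv ^^ Suc i) P"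
    unfolding mderiv_add mderiv_xmul mderiv_of_nat
    by (simp only: vec_eq_iff vector_add_component mat_of_nat_mult)
       (simp add: distrib_right)
  finally show ?case .
qed

text \<open>Operators act on the right, so constant matrices on the left are the scalars of the
  module on which they act.\<close>

definition left_linear ::
  "(('l::finite, 'm::finite) mpoly \<Rightarrow> ('l, 'n::finite) mpoly) \<Rightarrow> bool" where
  "left_linear T \<longleftrightarrow> (\<forall>P Q. T (P + Q) = T P + T Q) \<and> (\<forall>A P. T (mconst A ** P) = mconst A ** T P)"

lemma left_linear_add: "left_linear T \<Longrightarrow> T (P + Q) = T P + T Q"
  by (simp add: left_linear_def)

lemma left_linear_mconst: "left_linear T \<Longrightarrow> T (mconst A ** P) = mconst A ** T P"
  by (simp add: left_linear_def)

lemma left_linear_0: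
  assumes "left_linear T" shows "T 0 = 0"
  using left_linear_add[OF assms, of 0 0] by simp

lemma left_linear_sum: "left_linear T \<Longrightarrow> T (\<Sum>i\<in>I. P i) = (\<Sum>i\<in>I. T (P i))"
  by (induction I rule: infinite_finite_induct) (simp_all add: left_linear_add left_linear_0)

lemma xmul_mconst: "xmul (mconst A ** P) = mconst A ** xmul P"
  by (rule xmul_mult_right)

lemma mderiv_mconst_mult: "mderiv (mconst A ** P) = mconst A ** mderiv P"
proof -
  have "mderiv (mconst A) = 0"
    by (simp add: mderiv_def mconst_def vec_eq_iff pderiv_pCons)
  then show ?thesis
    by (simp add: mderiv_mult)
qed

lemma mderiv_pow_mconst_mult: "(mderiv ^^ i) (mconst A ** P) = mconst A ** (mderiv ^^ i) P"
  by (induction i) (simp_all add: mderiv_mconst_mult)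

lemma mderiv_pow_add: "(mderiv ^^ i) (P + Q) = (mderiv ^^ i) P + (mderiv ^^ i) Q"
  by (induction i) (simp_all add: mderiv_add)

lemma left_linear_diffop:
  "left_linear (\<lambda>P. \<Sum>i\<in>I. (mderiv ^^ i) P ** F i)"
  unfolding left_linear_def
  by (simp add: mderiv_pow_add mderiv_pow_mconst_mult matrix_add_rdistrib sum.distrib
      matrix_mul_assoc[symmetric] matrix_mul_sum)

lemma left_linear_act: "left_linear (\<lambda>P. act P D)"
  unfolding act_def by (rule left_linear_diffop)

text \<open>The commutator of \<open>T\<close> with multiplication by x. On differential operators
  it lowers the order, which makes the order visible without reference to coefficients.\<close>

definition commx ::
  "(('l::finite, 'm::finite) mpoly \<Rightarrow> ('l, 'n::finite) mpoly) \<Rightarrow> ('l, 'm) mpoly \<Rightarrow> ('l, 'n) mpoly"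
  where "commx T P = T (xmul P) - xmul (T P)"

lemma left_linear_commx: "left_linear T \<Longrightarrow> left_linear (commx T)"
  by (simp add: left_linear_def commx_def xmul_add xmul_mconst matrix_diff_ldistrib)

text \<open>The coefficients commute with x and the commutator of the power i of the derivative with
  x is i times the power i - 1. Hence \<open>commx\<close> differentiates the symbol formally with
  respect to the derivative.\<close>

lemma commx_diffop:
  fixes F :: "nat \<Rightarrow> ('m::finite, 'n::finite) mpoly"
  shows "commx (\<lambda>P :: ('l::finite, 'm) mpoly. \<Sum>i<Suc m. (mderiv ^^ i) P ** F i) =
    (\<lambda>P. \<Sum>i<m. (mderiv ^^ i) P ** (mat (of_nat (Suc i)) ** F (Suc i)))"
proof
  fix P :: "('l, 'm) mpoly"
  have "(mderiv ^^ Suc i) (xmul P) ** F (Suc i) = xmul ((mderiv ^^ Suc i) P ** F (Suc i)) +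
      (mderiv ^^ i) P ** (mat (of_nat (Suc i)) ** F (Suc i))" for i
    unfolding mderiv_pow_Suc_xmul matrix_add_rdistrib xmul_mult_left
    by (metis mat_of_nat_comm matrix_mul_assoc)
  then show "commx (\<lambda>P. \<Sum>i<Suc m. (mderiv ^^ i) P ** F i) P =
      (\<Sum>i<m. (mderiv ^^ i) P ** (mat (of_nat (Suc i)) ** F (Suc i)))"
    unfolding commx_def sum.lessThan_Suc_shift xmul_sum
    by (simp add: sum.distrib xmul_add xmul_sum xmul_mult_left del: funpow.simps)
qed

text \<open>Counting terms instead of the order lets the induction start at the empty sum, the zero
  operator.\<close>

lemma commx_pow_diffop:
  fixes F :: "nat \<Rightarrow> ('m::finite, 'n::finite) mpoly"
  shows "(commx ^^ m) (\<lambda>P :: ('l::finite, 'm) mpoly. \<Sum>i<m. (mderiv ^^ i) P ** F i) = (\<lambda>P. 0)"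
proof (induction m arbitrary: F)
  case (Suc m)
  then show ?case
    by (simp add: funpow_Suc_right commx_diffop del: funpow.simps sum.lessThan_Suc)
qed simp

lemma commx_pow_act:
  fixes D :: "('m::finite, 'n::finite) diffop"
  shows "(commx ^^ Suc (degree D)) (\<lambda>P :: ('l::finite, 'm) mpoly. act P D) = (\<lambda>P. 0)"
  unfolding act_def lessThan_Suc_atMost[symmetric] by (rule commx_pow_diffop)

lemma mcoeff_xpow: "mcoeff (mat (monom 1 n) :: ('m::finite, 'm) mpoly) k = (if k = n then mat 1 else 0)"
  by (simp add: mcoeff_def mat_def vec_eq_iff)

lemma mpoly_expand:
  fixes P :: "('l::finite, 'm::finite) mpoly"
  shows "P = (\<Sum>k\<le>mdegree P. mconst (mcoeff P k) ** mat (monom 1 k))"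
proof (rule mpoly_eqI)
  fix k
  show "mcoeff P k = mcoeff (\<Sum>k\<le>mdegree P. mconst (mcoeff P k) ** mat (monom 1 k)) k"
    by (simp add: mcoeff_sum mcoeff_xpow if_distrib mcoeff_eq_0 not_le cong: if_cong)
qed

lemma mat_monom_Suc: "mat (monom 1 (Suc n)) = xmul (mat (monom 1 n) :: ('m::finite, 'm) mpoly)"
  by (simp add: mat_def xmul_def vec_eq_iff monom_Suc)

text \<open>Every matrix polynomial is a combination of powers of x with constant left coefficients,
  so such a \<open>T\<close> is determined by its value at the identity. This is why the arguments
  of \<open>T\<close> are square.\<close>

lemma left_linear_xmul_commute:
  fixes T :: "('m::finite, 'm) mpoly \<Rightarrow> ('m, 'n::finite) mpoly"
  assumes T: "left_linear T" and 0: "commx T = (\<lambda>P. 0)"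
  shows "T P = P ** T (mat 1)"
proof -
  have "T (mat (monom 1 n)) = mat (monom 1 n) ** T (mat 1)" for n
  proof (induction n)
    case (Suc n)
    have "T (xmul Q) = xmul (T Q)" for Q
      using fun_cong[OF 0, of Q] by (simp add: commx_def)
    then show ?case
      by (simp add: mat_monom_Suc Suc xmul_mult_left)
  qed (simp add: monom_0 flip: one_pCons)
  then have "T (\<Sum>k\<le>n. mconst (C k) ** mat (monom 1 k)) =
      (\<Sum>k\<le>n. mconst (C k) ** mat (monom 1 k)) ** T (mat 1)" for n C
    by (simp add: left_linear_sum[OF T] left_linear_mconst[OF T] matrix_mul_sum matrix_mul_assoc)
  from this[of "mcoeff P" "mdegree P"] show ?thesis
    by (simp add: mpoly_expand[of P, symmetric])
qed

text \<open>Integrating the symbol of the commutator once reduces \<open>T\<close> to an operator that commutes with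
  \<open>x\<close>, which is multiplication by a matrix polynomial.\<close>

lemma diffop_if_commx_pow_0:
  fixes T :: "('m::finite, 'm) mpoly \<Rightarrow> ('m, 'n::finite) mpoly"
  assumes "left_linear T" "(commx ^^ m) T = (\<lambda>P. 0)"
  shows "\<exists>F. \<forall>P. T P = (\<Sum>i<m. (mderiv ^^ i) P ** F i)"
  using assms
proof (induction m arbitrary: T)
  case (Suc m)
  obtain G where G: "\<And>P. commx T P = (\<Sum>i<m. (mderiv ^^ i) P ** G i)"
    using Suc.IH[of "commx T"] Suc.prems left_linear_commx[of T]
    by (auto simp: funpow_Suc_right simp del: funpow.simps)
  \<comment> \<open>The shift and the division by k + 1 undo \<open>commx_diffop\<close>. The
    constant of integration \<open>F 0\<close> is provisionally 0.\<close>
  define F where "F i = (case i of 0 \<Rightarrow> 0 | Suc k \<Rightarrow> mconst (mat (1 / of_nat (Suc k))) ** G k)" for i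
  define S where "S = (\<lambda>P :: ('m, 'm) mpoly. \<Sum>i<Suc m. (mderiv ^^ i) P ** F i)"
  have S: "left_linear S" unfolding S_def by (rule left_linear_diffop)
  have "mat (of_nat (Suc i)) ** F (Suc i) = G i" for i
  proof (rule mpoly_eqI)
    fix k
    have "mat (of_nat (Suc i)) ** F (Suc i) = mconst (mat (of_nat (Suc i))) ** F (Suc i)"
      by (rule arg_cong[where f = "\<lambda>A. A ** _"])
         (simp add: mat_def mconst_def vec_eq_iff of_nat_poly)
    moreover have "mat c ** (mat (1 / c) ** B) = B" if "c \<noteq> 0" for c and B :: "complex ^ 'n ^ 'm"
      using that by (simp add: mat_mult_entry vec_eq_iff)
    ultimately show "mcoeff (mat (of_nat (Suc i)) ** F (Suc i)) k = mcoeff (G i) k"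
      by (simp add: F_def del: of_nat_Suc)
  qed
  then have cS: "commx S P = commx T P" for P
    unfolding S_def by (simp add: commx_diffop G del: of_nat_Suc sum.lessThan_Suc)
  define U where "U = (\<lambda>P. T P - S P)"
  have "left_linear U"
    using Suc.prems(1) S by (simp add: U_def left_linear_def matrix_diff_ldistrib)
  moreover have "commx U = (\<lambda>P. 0)"
    using cS by (simp add: fun_eq_iff U_def commx_def xmul_diff algebra_simps)
  ultimately have "U P = P ** U (mat 1)" for P
    by (rule left_linear_xmul_commute)
  then have "T P = P ** U (mat 1) + S P" for P
    by (metis U_def diff_add_cancel)
  \<comment> \<open>The multiplication operator left over is the constant of integration and fills
    the free slot \<open>F 0\<close>.\<close>
  also have "P ** U (mat 1) + S P = (\<Sum>i<Suc m. (mderiv ^^ i) P ** (F(0 := U (mat 1))) i)" for P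
    unfolding S_def sum.lessThan_Suc_shift by (simp add: F_def)
  finally show ?case by blast
qed simp

lemma act_if_commx_pow_0:
  fixes T :: "('m::finite, 'm) mpoly \<Rightarrow> ('m, 'n::finite) mpoly"
  assumes "left_linear T" "(commx ^^ m) T = (\<lambda>P. 0)"
  obtains D where "\<And>P. T P = act P D"
proof -
  obtain F where "\<And>P. T P = (\<Sum>i<m. (mderiv ^^ i) P ** F i)"
    using diffop_if_commx_pow_0[OF assms] by blast
  then have "T P = act P (\<Sum>i<m. monom (F i) i)" for P
    by (simp add: act_sum act_monom)
  then show ?thesis by (rule that)
qed

section \<open>Invertible matrices\<close>

lemma matrix_inv_right: "invertible A \<Longrightarrow> A ** matrix_inv A = mat 1"
  and matrix_inv_left: "invertible A \<Longrightarrow> matrix_inv A ** A = mat 1"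
  unfolding invertible_def matrix_inv_def by (metis (mono_tags, lifting) someI_ex)+

lemma mult_invertible_right_eq_0_iff:
  fixes B :: "'a::semiring_1 ^ 'n::finite ^ 'n" and A :: "'a ^ 'n ^ 'm::finite"
  assumes "invertible B"
  shows "A ** B = 0 \<longleftrightarrow> A = 0"
proof
  obtain B' where "B ** B' = mat 1"
    using assms by (auto simp: invertible_def)
  then have "A = (A ** B) ** B'"
    by (simp add: matrix_mul_assoc[symmetric])
  then show "A ** B = 0 \<Longrightarrow> A = 0"
    by simp
qed simp

text \<open>Dependent rows give a nonzero left null vector. It is packed into a square matrix so
  that \<open>mconst U\<close> can multiply the members of an orthogonal sequence without changing
  their type.\<close>

lemma not_invertible_annihilator:
  fixes A :: "'a::field ^ 'n::finite ^ 'n"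
  assumes "\<not> invertible A"
  obtains U :: "'a ^ 'n ^ 'n" where "U \<noteq> 0" "U ** A = 0"
proof -
  obtain c i where c: "(\<Sum>i\<in>UNIV. c i *s row i A) = 0" "c i \<noteq> 0"
    using assms unfolding invertible_right_inverse matrix_right_invertible_independent_rows by blast
  \<comment> \<open>All rows of \<open>U\<close> are the same null vector.\<close>
  define U :: "'a ^ 'n ^ 'n" where "U = (\<chi> r i. c i)"
  have "U ** A = 0"
    using c(1) by (simp add: U_def vec_eq_iff matrix_matrix_mult_def row_def)
  moreover have "U \<noteq> 0"
    using c(2) by (auto simp: U_def vec_eq_iff)
  ultimately show ?thesis using that by blast
qed

text \<open>Independence of the range, as a set, does not notice repeated rows; together with
  \<open>inj\<close> it expresses independence of the family.\<close>

lemma invertible_iff_independent_rows: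
  fixes A :: "'a::field ^ 'n::finite ^ 'n"
  shows "invertible A \<longleftrightarrow> inj (($) A) \<and> vec.independent (range (($) A))"
proof -
  have row: "row i A = A $ i" for i
    by (simp add: row_def vec_eq_iff)
  show ?thesis
    unfolding invertible_right_inverse matrix_right_invertible_independent_rows row
  proof safe
    assume *: "\<forall>c. (\<Sum>i\<in>UNIV. c i *s A $ i) = 0 \<longrightarrow> (\<forall>i. c i = 0)"
    show inj: "inj (($) A)"
    proof (rule injI, rule ccontr)
      fix i j assume ij: "A $ i = A $ j" "i \<noteq> j"
      define c where "c k = (if k = i then 1 else if k = j then - 1 else 0 :: 'a)" for k
      have "(\<Sum>k\<in>UNIV. c k *s A $ k) = (\<Sum>k\<in>{i, j}. c k *s A $ k)"
        by (rule sum.mono_neutral_right) (auto simp: c_def)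
      also have "\<dots> = 0"
        using ij by (simp add: c_def vec_eq_iff)
      finally have "c i = 0" using * by blast
      then show False by (simp add: c_def)
    qed
    assume "vec.dependent (range (($) A))"
    then obtain u v where u: "(\<Sum>v\<in>range (($) A). u v *s v) = 0" "v \<in> range (($) A)" "u v \<noteq> 0"
      by (auto simp: vec.dependent_finite)
    have "(\<Sum>i\<in>UNIV. u (A $ i) *s A $ i) = 0"
      using u(1) by (simp add: sum.reindex[OF inj])
    then show False using * u by fastforce
  next
    fix c i
    assume inj: "inj (($) A)" and ind: "vec.independent (range (($) A))"
      and c: "(\<Sum>i\<in>UNIV. c i *s A $ i) = 0"
    \<comment> \<open>Injectivity turns coefficients indexed by rows into a function on the set of
      row vectors, as set independence requires.\<close>
    have "(\<Sum>v\<in>range (($) A). c (inv (($) A) v) *s v) = 0"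
      using c by (simp add: sum.reindex[OF inj] inv_f_f[OF inj])
    then have "c (inv (($) A) (A $ i)) = 0"
      using vec.independentD[OF ind, of "range (($) A)" "\<lambda>v. c (inv (($) A) v)"] by simp
    then show "c i = 0" by (simp add: inv_f_f[OF inj])
  qed
qed

section \<open>Sequences with one polynomial in each degree\<close>

text \<open>The algebraic half of \<open>orthogonal_polys\<close>: such a sequence is a basis of the
  matrix polynomials as a left module over constant matrices. Degree arguments can then ignore the
  weight.\<close>

definition graded :: "(nat \<Rightarrow> ('n::finite, 'n) mpoly) \<Rightarrow> bool" where
  "graded P \<longleftrightarrow> (\<forall>n. mdegree (P n) = n \<and> invertible (mcoeff (P n) n))"

lemma graded_mdegree: "graded P \<Longrightarrow> mdegree (P n) = n"
  and graded_invertible: "graded P \<Longrightarrow> invertible (mcoeff (P n) n)"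
  by (simp_all add: graded_def)

text \<open>Subtracting a multiple of \<open>P n\<close> removes the top coefficient, since the
  leading coefficient of \<open>P n\<close> is invertible. The strict bound starts the induction at
  the zero polynomial.\<close>

lemma graded_expand_less:
  fixes P :: "nat \<Rightarrow> ('n::finite, 'n) mpoly" and Q :: "('n, 'n) mpoly"
  assumes P: "graded P" and "\<And>k. k \<ge> n \<Longrightarrow> mcoeff Q k = 0"
  shows "\<exists>C. Q = (\<Sum>k<n. mconst (C k) ** P k)"
  using assms(2)
proof (induction n arbitrary: Q)
  case 0
  then show ?case by (simp add: mpoly_eqI)
next
  case (Suc n)
  define c where "c = mcoeff Q n ** matrix_inv (mcoeff (P n) n)"
  have c: "c ** mcoeff (P n) n = mcoeff Q n"
    using graded_invertible[OF P, of n]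
    by (simp add: c_def matrix_mul_assoc[symmetric] matrix_inv_left)
  have "mcoeff (Q - mconst c ** P n) k = 0" if "k \<ge> n" for k
    using that c Suc.prems[of k] graded_mdegree[OF P, of n]
    by (cases "k = n") (simp_all add: mcoeff_diff mcoeff_eq_0)
  then obtain C where "Q - mconst c ** P n = (\<Sum>k<n. mconst (C k) ** P k)"
    using Suc.IH by blast
  then have "Q = (\<Sum>k<Suc n. mconst ((C(n := c)) k) ** P k)"
    by (simp add: algebra_simps)
  then show ?case by blast
qed

lemma graded_expand:
  fixes P :: "nat \<Rightarrow> ('n::finite, 'n) mpoly" and Q :: "('n, 'n) mpoly"
  assumes "graded P" "mdegree Q \<le> n"
  obtains C where "Q = (\<Sum>k\<le>n. mconst (C k) ** P k)"
  using graded_expand_less[OF assms(1), of "Suc n" Q] assms(2)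
  by (auto simp: mdegree_le_iff Suc_le_eq lessThan_Suc_atMost)

lemma graded_mcoeff_sum:
  fixes P :: "nat \<Rightarrow> ('n::finite, 'n) mpoly" and C :: "nat \<Rightarrow> complex ^ 'n ^ 'n"
  assumes "graded P"
  shows "mdegree (\<Sum>k\<le>n. mconst (C k) ** P k) \<le> n"
    and "mcoeff (\<Sum>k\<le>n. mconst (C k) ** P k) n = C n ** mcoeff (P n) n"
proof -
  show "mdegree (\<Sum>k\<le>n. mconst (C k) ** P k) \<le> n"
    unfolding mdegree_le_iff
    by (simp add: mcoeff_sum graded_mdegree[OF assms] mcoeff_eq_0)
  have "(\<Sum>k<n. C k ** mcoeff (P k) n) = 0"
    by (intro sum.neutral) (simp add: graded_mdegree[OF assms] mcoeff_eq_0)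
  then show "mcoeff (\<Sum>k\<le>n. mconst (C k) ** P k) n = C n ** mcoeff (P n) n"
    by (simp add: mcoeff_sum mcoeff_add lessThan_Suc_atMost[symmetric])
qed

text \<open>Only the summand of index n reaches degree n, so \<open>T\<close> acts on top
  coefficients by right multiplication with a fixed matrix. This matrix is invertible exactly when
  \<open>A n\<close> is, which links \<open>A n\<close> to the preservation of degrees.\<close>

lemma graded_action:
  fixes T :: "('n::finite, 'n) mpoly \<Rightarrow> ('n, 'n) mpoly"
  assumes "graded P" "graded Q" "left_linear T" "\<And>k. T (P k) = mconst (A k) ** Q k"
    and "mdegree f \<le> n"
  shows "mdegree (T f) \<le> n"
    and "mcoeff (T f) n =
      mcoeff f n ** (matrix_inv (mcoeff (P n) n) ** A n ** mcoeff (Q n) n)"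
proof -
  obtain C where C: "f = (\<Sum>k\<le>n. mconst (C k) ** P k)"
    using graded_expand[OF assms(1,5)] by blast
  have Tf: "T f = (\<Sum>k\<le>n. mconst (C k ** A k) ** Q k)"
    by (simp add: C left_linear_sum[OF assms(3)] left_linear_mconst[OF assms(3)] assms(4) mconst_mult)
  show "mdegree (T f) \<le> n"
    unfolding Tf by (rule graded_mcoeff_sum(1)[OF assms(2)])
  have "mcoeff (T f) n = C n ** A n ** mcoeff (Q n) n"
    unfolding Tf by (rule graded_mcoeff_sum(2)[OF assms(2)])
  moreover have "C n = mcoeff f n ** matrix_inv (mcoeff (P n) n)"
    using graded_invertible[OF assms(1), of n]
    by (simp add: C graded_mcoeff_sum(2)[OF assms(1)] matrix_mul_assoc[symmetric] matrix_inv_right)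
  ultimately show "mcoeff (T f) n =
      mcoeff f n ** (matrix_inv (mcoeff (P n) n) ** A n ** mcoeff (Q n) n)"
    by (simp add: matrix_mul_assoc)
qed

lemma invertible_matrix_inv: "invertible A \<Longrightarrow> invertible (matrix_inv A)"
  by (metis invertible_def matrix_inv_left matrix_inv_right)

text \<open>An invertible multiplier does not annihilate a nonzero top coefficient. Restricting to n
  > 0 guarantees that the top coefficient is nonzero.\<close>

lemma degree_preserving_if_invertible:
  fixes P :: "nat \<Rightarrow> ('n::finite, 'n) mpoly" and A :: "nat \<Rightarrow> complex ^ 'n::finite ^ 'n"
  assumes "graded P" "graded Q" "\<And>n. act (P n) V = mconst (A n) ** Q n"
    and "\<forall>\<^sub>\<infinity>n. invertible (A n)"
  shows "degree_preserving V"
proof -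
  have step: "mdegree (act f V) = n" if "invertible (A n)" "n > 0" "mdegree f = n"
    for n and f :: "('n, 'n) mpoly"
  proof (rule mdegree_eqI)
    note * = graded_action[OF assms(1,2) left_linear_act assms(3), of f n]
    show "mdegree (act f V) \<le> n"
      using * that by simp
    have "invertible (matrix_inv (mcoeff (P n) n) ** A n ** mcoeff (Q n) n)"
      using that(1) assms(1,2) by (simp add: invertible_mult invertible_matrix_inv graded_invertible)
    then show "mcoeff (act f V) n \<noteq> 0"
      using *(2) that mcoeff_mdegree[of f n] by (simp add: mult_invertible_right_eq_0_iff)
  qed
  have pos: "\<forall>\<^sub>\<infinity>n. n > (0 :: nat)"
    by (auto simp: MOST_nat)
  show ?thesis
    unfolding degree_preserving_def
    using MOST_conjI[OF assms(4) pos] by (rule MOST_mono) (use step in blast)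
qed

text \<open>If \<open>A n\<close> is singular, a left annihilator \<open>U\<close> yields a
  polynomial \<open>mconst U ** P n\<close> of degree n that the operator sends to 0.\<close>

lemma invertible_if_degree_preserving:
  fixes A :: "nat \<Rightarrow> complex ^ 'n::finite ^ 'n"
  assumes "graded P" "\<And>n. act (P n) V = mconst (A n) ** Q n" "degree_preserving V"
  shows "\<forall>\<^sub>\<infinity>n. invertible (A n)"
proof -
  have step: "invertible (A n)"
    if n: "\<forall>f :: ('n, 'n) mpoly. mdegree f = n \<longrightarrow> mdegree (act f V) = n" "n > 0" for n
  proof (rule ccontr)
    assume "\<not> invertible (A n)"
    then obtain U :: "complex ^ 'n ^ 'n" where U: "U \<noteq> 0" "U ** A n = 0"
      using not_invertible_annihilator by blast
    have "mdegree (mconst U ** P n) = n"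
    proof (rule mdegree_eqI)
      show "mdegree (mconst U ** P n) \<le> n"
        using graded_mdegree[OF assms(1), of n] by (simp add: mdegree_le_iff mcoeff_eq_0)
      show "mcoeff (mconst U ** P n) n \<noteq> 0"
        using U(1) graded_invertible[OF assms(1)] by (simp add: mult_invertible_right_eq_0_iff)
    qed
    then have "mdegree (act (mconst U ** P n) V) = n"
      using n by blast
    moreover have "act (mconst U ** P n) V = mconst (U ** A n) ** Q n"
      by (simp add: left_linear_mconst[OF left_linear_act] assms(2) mconst_mult)
    ultimately have "mdegree (0 :: ('n, 'n) mpoly) = n"
      using U(2) by simp
    then show False
      using n(2) by (simp add: mdegree_def image_constant_conv)
  qed
  have pos: "\<forall>\<^sub>\<infinity>n. n > (0 :: nat)"
    by (auto simp: MOST_nat)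
  show ?thesis
    using MOST_conjI[OF assms(3)[unfolded degree_preserving_def] pos]
    by (rule MOST_mono) (use step in blast)
qed

section \<open>Dependence of the top coefficients on n\<close>

text \<open>For i > n the falling factorial contains the factor 0, so the truncated exponent n - i
  is harmless.\<close>

lemma pderiv_pow_monom:
  "(pderiv ^^ i) (monom (1 :: complex) n) = monom (\<Prod>j<i. of_nat n - of_nat j) (n - i)"
proof (induction i)
  case (Suc i)
  show ?case
  proof (cases "i \<le> n")
    case True
    then show ?thesis
      by (simp add: Suc pderiv_monom of_nat_diff mult.commute)
  next
    case False
    then have "(\<Prod>j<i. of_nat n - of_nat j :: complex) = 0"
      by (intro prod_zero) auto
    then show ?thesis by (simp add: Suc pderiv_monom)
  qed
qed simp

lemma mderiv_pow_nth: "(mderiv ^^ i) P $ r $ s = (pderiv ^^ i) (P $ r $ s)"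
  by (induction i) (simp_all add: mderiv_def)

lemma mderiv_pow_xpow:
  "(mderiv ^^ i) (mat (monom 1 n) :: ('n::finite, 'n) mpoly) =
    mat (monom (\<Prod>j<i. of_nat n - of_nat j) (n - i))"
  by (simp add: vec_eq_iff mderiv_pow_nth mat_def pderiv_pow_monom)

text \<open>The term of order i contributes to the coefficient at n a falling factorial of n times
  the coefficient at i of its matrix. Both factors are given by one polynomial for all n, so
  \<open>M\<close> does not depend on n.\<close>

lemma mcoeff_act_xpow:
  fixes V :: "('n::finite, 'n) diffop"
  shows "\<exists>M :: ('n, 'n) mpoly. \<forall>n.
    mcoeff (act (mat (monom 1 n)) V) n = (\<chi> r s. poly (M $ r $ s) (of_nat n))"
proof (intro exI allI)
  fix n
  define M :: "('n, 'n) mpoly" where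
    "M = (\<chi> r s. \<Sum>i\<le>degree V. smult (coeff (coeff V i $ r $ s) i) (\<Prod>j<i. [:- of_nat j, 1:]))"
  have "coeff (monom c (n - i) * F) n = c * coeff F i"
    if "c = (\<Prod>j<i. of_nat n - of_nat j)" for c :: complex and i F
  proof (cases "i \<le> n")
    case False
    then have "c = 0" unfolding that by (intro prod_zero) auto
    then show ?thesis by simp
  qed (simp add: coeff_monom_mult)
  then show "mcoeff (act (mat (monom 1 n)) V) n = (\<chi> r s. poly (M $ r $ s) (of_nat n))"
    by (simp add: act_def mcoeff_sum mderiv_pow_xpow)
      (simp add: mcoeff_def vec_eq_iff mat_mult_entry M_def poly_sum poly_prod mult.commute)
qed

lemma poly_det:
  fixes M :: "'a::comm_ring_1 poly ^ 'n::finite ^ 'n"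
  shows "poly (det M) x = det (\<chi> r s. poly (M $ r $ s) x)"
  by (simp add: det_def poly_sum poly_prod poly_of_int)

text \<open>The monomial of degree n has top coefficient 1, so applying the operator to it reads off
  the multiplier of \<open>graded_action\<close>. Its determinant is a polynomial in n that is
  nonzero at m, hence it has finitely many roots.\<close>

lemma MOST_invertible:
  fixes A :: "nat \<Rightarrow> complex ^ 'n::finite ^ 'n"
  assumes "graded P" "graded Q" "\<And>n. act (P n) V = mconst (A n) ** Q n" "invertible (A m)"
  shows "\<forall>\<^sub>\<infinity>n. invertible (A n)"
proof -
  obtain M :: "('n, 'n) mpoly" where
    M: "\<And>n. mcoeff (act (mat (monom 1 n)) V) n = (\<chi> r s. poly (M $ r $ s) (of_nat n))"
    using mcoeff_act_xpow by blast
  have *: "matrix_inv (mcoeff (P n) n) ** A n ** mcoeff (Q n) n =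
      (\<chi> r s. poly (M $ r $ s) (of_nat n))" for n
  proof -
    have "mdegree (mat (monom 1 n) :: ('n, 'n) mpoly) \<le> n"
      by (simp add: mdegree_le_iff mcoeff_xpow)
    from graded_action(2)[OF assms(1,2) left_linear_act assms(3) this]
    show ?thesis by (simp add: M mcoeff_xpow)
  qed
  have iff: "invertible (A n) \<longleftrightarrow> poly (det M) (of_nat n) \<noteq> 0" for n
    using arg_cong[OF *[of n], of det]
      graded_invertible[OF assms(1), of n] graded_invertible[OF assms(2), of n]
      invertible_matrix_inv[OF graded_invertible[OF assms(1), of n]]
    by (auto simp: det_mul invertible_det_nz poly_det)
  then have "det M \<noteq> 0"
    using assms(4) by auto
  then have "finite {x. poly (det M) x = 0}"
    by (rule poly_roots_finite)
  then have "finite (of_nat -` {x. poly (det M) x = 0} :: nat set)"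
    by (rule finite_vimageI) (simp add: inj_on_def)
  then show ?thesis
    by (simp add: MOST_iff_cofinite iff vimage_def)
qed

section \<open>Hermitian conjugation and evaluation\<close>

lemma matrix_scaleR_left: "(c *\<^sub>R A) ** B = c *\<^sub>R (A ** (B :: 'a::real_algebra_1 ^ 'k ^ 'm::finite))"
  by (simp add: vec_eq_iff matrix_matrix_mult_def scaleR_sum_right)

lemma matrix_scaleR_right: "A ** (c *\<^sub>R B) = c *\<^sub>R (A ** (B :: 'a::real_algebra_1 ^ 'k ^ 'm::finite))"
  by (simp add: vec_eq_iff matrix_matrix_mult_def scaleR_sum_right)

lemma hconj_mult: "hconj (A ** B) = hconj B ** hconj (A :: complex ^ 'n::finite ^ 'm)"
  by (simp add: hconj_def vec_eq_iff matrix_matrix_mult_def mult.commute)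

lemma hconj_hconj [simp]: "hconj (hconj A) = A"
  by (simp add: hconj_def)

lemma hconj_mat_1 [simp]: "hconj (mat 1) = (mat 1 :: complex ^ 'n ^ 'n)"
  by (simp add: hconj_def mat_def vec_eq_iff)

lemma hconj_0 [simp]: "hconj 0 = 0"
  by (simp add: hconj_def vec_eq_iff)

lemma hconj_add: "hconj (A + B) = hconj A + hconj B"
  by (simp add: hconj_def vec_eq_iff)

lemma hconj_sum: "hconj (\<Sum>i\<in>I. A i) = (\<Sum>i\<in>I. hconj (A i))"
  by (induction I rule: infinite_finite_induct) (simp_all add: hconj_add)

lemma hconj_scaleR: "hconj (c *\<^sub>R A) = c *\<^sub>R hconj A"
  by (simp add: hconj_def vec_eq_iff)

lemma invertible_hconj: "invertible A \<Longrightarrow> invertible (hconj (A :: complex ^ 'n::finite ^ 'n))"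
  unfolding invertible_def by (metis hconj_mat_1 hconj_mult)

lemma bounded_linear_hconj: "bounded_linear (hconj :: complex ^ 'n::finite ^ 'm::finite \<Rightarrow> _)"
  unfolding linear_conv_bounded_linear[symmetric]
  by (rule linearI) (simp_all add: hconj_add hconj_scaleR)

lemma bounded_linear_matrix_mult:
  "bounded_linear (\<lambda>X :: complex ^ 'n::finite ^ 'm::finite.
    (A :: complex ^ 'm ^ 'l::finite) ** X ** (B :: complex ^ 'k::finite ^ 'n))"
  unfolding linear_conv_bounded_linear[symmetric]
  by (rule linearI)
    (simp_all add: matrix_add_ldistrib matrix_add_rdistrib matrix_scaleR_left matrix_scaleR_right)

lemma meval_expand: "meval P x = (\<Sum>k\<le>mdegree P. x ^ k *\<^sub>R mcoeff P k)"
proof -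
  have "poly (P $ i $ j) (of_real x) = (\<Sum>k\<le>mdegree P. x ^ k *\<^sub>R coeff (P $ i $ j) k)" for i j
  proof -
    have "degree (P $ i $ j) \<le> mdegree P"
      unfolding mdegree_def by (intro Max_ge) (auto intro: rev_image_eqI[of "(i, j)"])
    then have "poly (P $ i $ j) (of_real x) = (\<Sum>k\<le>mdegree P. coeff (P $ i $ j) k * of_real x ^ k)"
      unfolding poly_altdef by (intro sum.mono_neutral_left) (auto simp: coeff_eq_0)
    then show ?thesis
      by (simp add: scaleR_conv_of_real mult.commute)
  qed
  then show ?thesis
    by (simp add: meval_def vec_eq_iff mcoeff_def)
qed

lemma meval_add: "meval (P + Q) x = meval P x + meval Q x"
  by (simp add: meval_def vec_eq_iff)

lemma meval_mconst_mult:
  "meval (mconst A ** P) x = A ** meval P x"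
  by (simp add: meval_def mconst_def vec_eq_iff matrix_matrix_mult_def poly_sum)

lemma meval_xmul: "meval (xmul P) x = x *\<^sub>R meval P x"
  by (simp add: meval_def xmul_def vec_eq_iff scaleR_conv_of_real[where 'a = complex])

text \<open>The roots of a nonzero polynomial form a finite, hence null, set, whereas a nonempty
  open interval has positive measure.\<close>

lemma poly_eq_0_if_AE:
  fixes q :: "complex poly"
  assumes "a < b" "AE x in lborel. x \<in> einterval a b \<longrightarrow> poly q (of_real x) = 0"
  shows "q = 0"
proof (rule ccontr)
  assume "q \<noteq> 0"
  then have "finite (of_real -` {z. poly q z = 0} :: real set)"
    by (intro finite_vimageI poly_roots_finite) (auto simp: inj_on_def)
  then have "AE x in lborel. x \<notin> (of_real -` {z. poly q z = 0} :: real set)"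
    by (intro AE_not_in finite_imp_null_set_lborel)
  with assms(2) have *: "AE x in lborel. x \<notin> einterval a b"
    by eventually_elim auto
  obtain c where c: "a < ereal c" "ereal c < b"
    using ereal_dense2[OF assms(1)] by blast
  obtain d where d: "ereal c < ereal d" "ereal d < b"
    using ereal_dense2[OF c(2)] by blast
  have "{c<..<d} \<subseteq> einterval a b"
    using c d by (auto simp: einterval_def intro: less_trans)
      (meson c(1) ereal_less_eq(3) less_imp_le order_le_less_trans order_less_le_trans)+
  then have "AE x in lborel. x \<notin> {c<..<d}"
    by (intro eventually_mono[OF *]) blast
  then have "{c<..<d} \<in> null_sets lborel"
    by (simp add: AE_iff_null_sets)
  then show False
    using d(1) by (auto simp: null_sets_def)
qed

section \<open>The inner product of a weight\<close>

text \<open>Finite moments make all inner products converge; positive definiteness on a nonempty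
  interval makes the form definite.\<close>

locale moment_weight =
  fixes a b :: ereal and W :: "real \<Rightarrow> complex ^ 'n ^ 'n::finite"
  assumes less: "a < b"
    and AE_pos_definite: "AE x in lborel. x \<in> einterval a b \<longrightarrow> pos_definite (W x)"
    and moments: "\<And>k. set_integrable lborel (einterval a b) (\<lambda>x. x ^ k *\<^sub>R W x)"
begin

abbreviation inn :: "('n, 'n) mpoly \<Rightarrow> ('n, 'n) mpoly \<Rightarrow> complex ^ 'n ^ 'n" where
  "inn \<equiv> winner a b W"

lemma integrable_inn:
  "set_integrable lborel (einterval a b) (\<lambda>x. meval P x ** W x ** hconj (meval Q x))"
proof -
  have "meval P x ** W x ** hconj (meval Q x) =
      (\<Sum>k\<le>mdegree P. \<Sum>l\<le>mdegree Q. mcoeff P k ** (x ^ (k + l) *\<^sub>R W x) ** hconj (mcoeff Q l))" for x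
    by (simp add: meval_expand hconj_sum matrix_mul_sum hconj_scaleR scaleR_sum_right
        matrix_scaleR_left matrix_scaleR_right power_add mult.commute sum.swap[of _ "{..mdegree Q}"])
  moreover have "set_integrable lborel (einterval a b)
      (\<lambda>x. mcoeff P k ** (x ^ (k + l) *\<^sub>R W x) ** hconj (mcoeff Q l))" for k l
    using integrable_bounded_linear[OF bounded_linear_matrix_mult moments[of "k + l", unfolded set_integrable_def]]
    by (simp add: set_integrable_def matrix_scaleR_left matrix_scaleR_right)
  ultimately show ?thesis
    by (simp only: set_integrable_def scaleR_sum_right Bochner_Integration.integrable_sum)
qed

text \<open>Linearity over the reals is meant, so \<open>L\<close> may be \<open>hconj\<close> or
  the real part of an entry as well as multiplication by a constant matrix.\<close>

lemma inn_bounded_linear: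
  assumes "bounded_linear L"
  shows "(LBINT x:einterval a b. L (meval P x ** W x ** hconj (meval Q x))) = L (inn P Q)"
  using integral_bounded_linear[OF assms integrable_inn[unfolded set_integrable_def]]
  by (simp add: winner_def set_lebesgue_integral_def
      linear_simps(5)[OF assms])

lemma inn_add_left: "inn (P + P') Q = inn P Q + inn P' Q"
  unfolding winner_def
  by (simp add: meval_add matrix_add_rdistrib integrable_inn)

lemma inn_mconst_left: "inn (mconst A ** P) Q = A ** inn P Q"
  using inn_bounded_linear[OF bounded_linear_matrix_mult[of A "mat 1"], of P Q]
  by (simp add: winner_def[of _ _ _ "mconst A ** P"] meval_mconst_mult matrix_mul_assoc)

text \<open>\<open>W\<close> is Hermitian only almost everywhere, so the integrands are compared
  almost everywhere and their measurability has to be supplied.\<close>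

lemma hconj_inn: "hconj (inn P Q) = inn Q P"
proof -
  have "hconj (inn P Q) = (LBINT x:einterval a b. hconj (meval P x ** W x ** hconj (meval Q x)))"
    by (rule inn_bounded_linear[OF bounded_linear_hconj, symmetric])
  also have "\<dots> = inn Q P"
    unfolding winner_def set_lebesgue_integral_def
  proof (rule integral_cong_AE)
    show "(\<lambda>x. indicat_real (einterval a b) x *\<^sub>R hconj (meval P x ** W x ** hconj (meval Q x)))
        \<in> borel_measurable lborel"
      using integrable_bounded_linear[OF bounded_linear_hconj integrable_inn[unfolded set_integrable_def], of P Q]
      by (simp add: hconj_scaleR borel_measurable_integrable)
    show "(\<lambda>x. indicat_real (einterval a b) x *\<^sub>R (meval Q x ** W x ** hconj (meval P x)))
        \<in> borel_measurable lborel"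
      using integrable_inn[of Q P] by (simp add: set_integrable_def borel_measurable_integrable)
    show "AE x in lborel. indicat_real (einterval a b) x *\<^sub>R hconj (meval P x ** W x ** hconj (meval Q x)) =
        indicat_real (einterval a b) x *\<^sub>R (meval Q x ** W x ** hconj (meval P x))"
      using AE_pos_definite
    proof eventually_elim
      fix x assume "x \<in> einterval a b \<longrightarrow> pos_definite (W x)"
      then show "indicat_real (einterval a b) x *\<^sub>R hconj (meval P x ** W x ** hconj (meval Q x)) =
          indicat_real (einterval a b) x *\<^sub>R (meval Q x ** W x ** hconj (meval P x))"
        by (cases "x \<in> einterval a b") (simp_all add: hconj_mult matrix_mul_assoc pos_definite_def)
    qed
  qed
  finally show ?thesis .
qed

lemma inn_add_right: "inn P (Q + Q') = inn P Q + inn P Q'"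
  by (metis hconj_add hconj_inn inn_add_left)

lemma inn_mconst_right: "inn P (mconst A ** Q) = inn P Q ** hconj A"
  by (metis hconj_inn hconj_mult inn_mconst_left)

lemma inn_0 [simp]: "inn 0 P = 0" "inn P 0 = 0"
  using inn_add_left[of 0 0 P] inn_add_right[of P 0 0] by simp_all

lemma inn_sum_left: "inn (\<Sum>i\<in>I. P i) Q = (\<Sum>i\<in>I. inn (P i) Q)"
  by (induction I rule: infinite_finite_induct) (simp_all add: inn_add_left)

lemma inn_sum_right: "inn P (\<Sum>i\<in>I. Q i) = (\<Sum>i\<in>I. inn P (Q i))"
  by (induction I rule: infinite_finite_induct) (simp_all add: inn_add_right)

lemma inn_diff_left: "inn (P - P') Q = inn P Q - inn P' Q"
  by (metis add_diff_cancel diff_add_cancel inn_add_left)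

lemma inn_diff_right: "inn P (Q - Q') = inn P Q - inn P Q'"
  by (metis add_diff_cancel diff_add_cancel inn_add_right)

lemma inn_xmul: "inn (xmul P) Q = inn P (xmul Q)"
  by (simp add: winner_def meval_xmul hconj_scaleR matrix_scaleR_left matrix_scaleR_right)

text \<open>Each diagonal entry of the integrand is the quadratic form of \<open>W\<close> at a
  conjugated row of \<open>P\<close>. A nonnegative integrand with integral 0 vanishes almost
  everywhere, so the polynomial entries in that row vanish.\<close>

lemma inn_self_eq_0D:
  assumes "inn P P = 0"
  shows "P = 0"
proof -
  have "P $ i $ j = 0" for i j
  proof (rule poly_eq_0_if_AE[OF less])
    define L where "L = (\<lambda>A :: complex ^ 'n ^ 'n. Re (A $ i $ i))"
    have L: "bounded_linear L"
      unfolding linear_conv_bounded_linear[symmetric] L_def by (rule linearI) simp_all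
    \<comment> \<open>The conjugate is taken because the form in \<open>pos_definite\<close>
      conjugates its left argument.\<close>
    define v where "v x = (\<chi> k. cnj (meval P x $ i $ k))" for x
    define f where "f x = indicator (einterval a b) x *\<^sub>R L (meval P x ** W x ** hconj (meval P x))" for x
    have f: "integrable lborel f"
      using integrable_bounded_linear[OF L integrable_inn[unfolded set_integrable_def], of P P]
      by (simp add: f_def[abs_def] linear_simps(5)[OF L])
    have int: "integral\<^sup>L lborel f = 0"
      using inn_bounded_linear[OF L, of P P] assms
      by (simp add: f_def[abs_def] set_lebesgue_integral_def linear_simps(3)[OF L])
    have L_eq: "L (meval P x ** W x ** hconj (meval P x)) =
        Re (\<Sum>k\<in>UNIV. \<Sum>l\<in>UNIV. cnj (v x $ k) * W x $ k $ l * v x $ l)" for x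
    proof -
      have "L (meval P x ** W x ** hconj (meval P x)) =
        Re (\<Sum>l\<in>UNIV. \<Sum>k\<in>UNIV. cnj (v x $ k) * W x $ k $ l * v x $ l)"
        by (simp add: L_def matrix_matrix_mult_def hconj_def v_def sum_distrib_right)
      then show ?thesis
        by (subst sum.swap)
    qed
    have pos: "AE x in lborel. x \<in> einterval a b \<longrightarrow> v x \<noteq> 0 \<longrightarrow> f x > 0"
      using AE_pos_definite
    proof eventually_elim
      fix x assume "x \<in> einterval a b \<longrightarrow> pos_definite (W x)"
      then show "x \<in> einterval a b \<longrightarrow> v x \<noteq> 0 \<longrightarrow> f x > 0"
        unfolding f_def L_eq pos_definite_def by simp
    qed
    have "AE x in lborel. f x \<ge> 0"
      using pos
    proof eventually_elim
      fix x assume *: "x \<in> einterval a b \<longrightarrow> v x \<noteq> 0 \<longrightarrow> f x > 0"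
      have "f x = 0" if "x \<notin> einterval a b \<or> v x = 0"
        using that unfolding f_def L_eq by auto
      with * show "f x \<ge> 0" by force
    qed
    then have "AE x in lborel. f x = 0"
      using integral_nonneg_eq_0_iff_AE[OF f] int by simp
    with pos show "AE x in lborel. x \<in> einterval a b \<longrightarrow> poly (P $ i $ j) (of_real x) = 0"
    proof eventually_elim
      fix x assume "x \<in> einterval a b \<longrightarrow> v x \<noteq> 0 \<longrightarrow> f x > 0" "f x = 0"
      then have "x \<in> einterval a b \<longrightarrow> v x $ j = 0" by auto
      then show "x \<in> einterval a b \<longrightarrow> poly (P $ i $ j) (of_real x) = 0"
        by (simp add: v_def meval_def)
    qed
  qed
  then show ?thesis by (simp add: vec_eq_iff)
qed

text \<open>A left annihilator \<open>U\<close> of the matrix norm would give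
  \<open>mconst U ** P\<close> norm 0, contradicting definiteness.\<close>

lemma invertible_inn:
  assumes "invertible (mcoeff P n)"
  shows "invertible (inn P P)"
proof (rule ccontr)
  assume "\<not> invertible (inn P P)"
  then obtain U :: "complex ^ 'n ^ 'n" where U: "U \<noteq> 0" "U ** inn P P = 0"
    using not_invertible_annihilator by blast
  then have "inn (mconst U ** P) (mconst U ** P) = 0"
    by (simp add: inn_mconst_left inn_mconst_right matrix_mul_assoc)
  then have "mconst U ** P = 0"
    by (rule inn_self_eq_0D)
  then have "U ** mcoeff P n = 0"
    by (metis mcoeff_0 mcoeff_mconst_mult)
  then show False
    using U(1) assms by (simp add: mult_invertible_right_eq_0_iff)
qed

lemma inn_degree_less:
  assumes "orthogonal_polys a b W P" "graded P" "mdegree Q < n"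
  shows "inn Q (P n) = 0"
proof -
  obtain C where "Q = (\<Sum>k\<le>mdegree Q. mconst (C k) ** P k)"
    using graded_expand[OF assms(2) order_refl] by blast
  moreover have "inn (\<Sum>k\<le>m. mconst (C k) ** P k) (P n) = 0" if "m < n" for m
    using that assms(1) by (auto simp: inn_sum_left inn_mconst_left orthogonal_polys_def intro!: sum.neutral)
  ultimately show ?thesis
    using assms(3) by metis
qed

end

section \<open>Adjoints of differential operators\<close>

lemma orthogonal_polys_graded: "orthogonal_polys a b W P \<Longrightarrow> graded P"
  by (simp add: orthogonal_polys_def graded_def)

text \<open>Multiplication by \<open>x\<close> is symmetric, so taking adjoints turns commutators with \<open>x\<close> into
  commutators with \<open>x\<close>, up to sign.\<close>

lemma commx_pow_adjoint:
  fixes w W :: "real \<Rightarrow> complex ^ 'n ^ 'n::finite"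
  assumes "moment_weight a b w" "moment_weight a b W"
    and "\<And>P Q. winner a b W (S P) Q = winner a b w P (T Q)"
  shows "winner a b W ((commx ^^ m) S P) Q = (- 1) ^ m *\<^sub>R winner a b w P ((commx ^^ m) T Q)"
proof (induction m arbitrary: P Q)
  case (Suc m)
  interpret w: moment_weight a b w by fact
  interpret W: moment_weight a b W by fact
  have Suc_pow: "(commx ^^ Suc m) F R = (commx ^^ m) F (xmul R) - xmul ((commx ^^ m) F R)"
    for F :: "('n, 'n) mpoly \<Rightarrow> ('n, 'n) mpoly" and R
    by (simp add: commx_def[of "(commx ^^ m) F"])
  show ?case
    unfolding Suc_pow W.inn_diff_left w.inn_diff_right W.inn_xmul Suc w.inn_xmul
    by (simp add: algebra_simps)
qed (simp add: assms(3))

text \<open>The adjoint is first built as a mere left-linear map \<open>T\<close> from expansions in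
  the two orthogonal sequences. Vanishing of its iterated commutators with x then shows that it is a
  differential operator with polynomial coefficients.\<close>

lemma adjoint_diffop:
  fixes w W :: "real \<Rightarrow> complex ^ 'n ^ 'n::finite"
  assumes w: "moment_weight a b w" and W: "moment_weight a b W"
    and p: "orthogonal_polys a b w p" and P: "orthogonal_polys a b W P"
    and A: "\<And>n. act (p n) V = mconst (A n) ** P n"
  obtains N where "\<And>n. act (P n) N =
    mconst (winner a b W (P n) (P n) ** hconj (A n) ** matrix_inv (winner a b w (p n) (p n))) ** p n"
proof -
  interpret w: moment_weight a b w by fact
  interpret W: moment_weight a b W by fact
  note gp = orthogonal_polys_graded[OF p] and gP = orthogonal_polys_graded[OF P]
  define B where "B k = hconj (A k) ** matrix_inv (w.inn (p k) (p k))" for k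
  \<comment> \<open>The coefficient of \<open>P k\<close> in \<open>Q\<close> is
    \<open>W.inn Q (P k)\<close> times the inverse norm of \<open>P k\<close>. That inverse cancels
    against the norm in the prescribed image of \<open>P k\<close>, leaving
    \<open>B k\<close>.\<close>
  define T where "T Q = (\<Sum>k\<le>mdegree Q. mconst (W.inn Q (P k) ** B k) ** p k)" for Q
  \<comment> \<open>\<open>Q\<close> is orthogonal to every \<open>P k\<close> of larger degree, so
    the cutoff may be raised. Polynomials of different degrees can thus share one summation
    range.\<close>
  have T: "T Q = (\<Sum>k\<le>n. mconst (W.inn Q (P k) ** B k) ** p k)" if "mdegree Q \<le> n" for Q n
    unfolding T_def using that W.inn_degree_less[OF P gP, of Q]
    by (intro sum.mono_neutral_left) auto
  have linear: "left_linear T"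
    unfolding left_linear_def
  proof safe
    fix Q R :: "('n, 'n) mpoly"
    define n where "n = max (mdegree Q) (mdegree R)"
    have "mdegree Q \<le> n" "mdegree R \<le> n"
      by (simp_all add: n_def)
    moreover from this have "mdegree (Q + R) \<le> n"
      by (simp add: mdegree_le_iff mcoeff_add)
    ultimately show "T (Q + R) = T Q + T R"
      by (simp add: T W.inn_add_left matrix_add_rdistrib mconst_add_mult sum.distrib)
  next
    fix C :: "complex ^ 'n ^ 'n" and Q :: "('n, 'n) mpoly"
    have "mdegree (mconst C ** Q) \<le> mdegree Q"
      unfolding mdegree_le_iff by (simp add: mcoeff_eq_0)
    then show "T (mconst C ** Q) = mconst C ** T Q"
      by (simp add: T[of _ "mdegree Q"] W.inn_mconst_left matrix_mul_sum
          matrix_mul_assoc[symmetric] mconst_mult)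
  qed
  have adj_p: "W.inn (act (p k) V) Q = w.inn (p k) (T Q)" for k Q
  proof -
    define n where "n = max k (mdegree Q)"
    have n: "mdegree Q \<le> n" "k \<le> n" by (simp_all add: n_def)
    have inv: "invertible (w.inn (p k) (p k))"
      by (rule w.invertible_inn[OF graded_invertible[OF gp]])
    have "w.inn (p k) (T Q) = (\<Sum>l\<le>n. w.inn (p k) (p l) ** hconj (W.inn Q (P l) ** B l))"
      by (simp add: T[OF n(1)] w.inn_sum_right w.inn_mconst_right)
    also have "\<dots> = (\<Sum>l\<le>n. if l = k then w.inn (p k) (p k) ** hconj (W.inn Q (P k) ** B k) else 0)"
      using p by (intro sum.cong) (auto simp: orthogonal_polys_def)
    also have "\<dots> = hconj (matrix_inv (w.inn (p k) (p k)) ** w.inn (p k) (p k)) ** A k ** W.inn (P k) Q"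
      using n(2) by (simp add: B_def hconj_mult w.hconj_inn W.hconj_inn matrix_mul_assoc)
    also have "\<dots> = W.inn (act (p k) V) Q"
      by (simp add: matrix_inv_left[OF inv] A W.inn_mconst_left)
    finally show ?thesis ..
  qed
  have adj: "W.inn (act R V) Q = w.inn R (T Q)" for R Q
  proof -
    obtain C where C: "R = (\<Sum>k\<le>mdegree R. mconst (C k) ** p k)"
      using graded_expand[OF gp order_refl] by blast
    have "W.inn (act (\<Sum>k\<le>n. mconst (C k) ** p k) V) Q =
        w.inn (\<Sum>k\<le>n. mconst (C k) ** p k) (T Q)" for n
      by (simp add: left_linear_sum[OF left_linear_act] left_linear_mconst[OF left_linear_act]
          W.inn_sum_left W.inn_mconst_left w.inn_sum_left w.inn_mconst_left adj_p)
    from this[of "mdegree R"] show ?thesis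
      unfolding C[symmetric] .
  qed
  \<comment> \<open>The adjoint identity is paired with the iterated commutator of \<open>T\<close>
    itself. The corresponding commutator of \<open>V\<close> is 0, so this polynomial has norm
    0.\<close>
  have "(commx ^^ Suc (degree V)) T Q = 0" for Q
    using commx_pow_adjoint[OF w W adj, of "Suc (degree V)" "(commx ^^ Suc (degree V)) T Q" Q]
    by (intro w.inn_self_eq_0D) (simp add: commx_pow_act del: funpow.simps)
  then obtain N where N: "\<And>Q. T Q = act Q N"
    using act_if_commx_pow_0[OF linear, of "Suc (degree V)"] by blast
  have "T (P n) = mconst (W.inn (P n) (P n) ** B n) ** p n" for n
  proof -
    have "T (P n) = (\<Sum>k\<le>n. if k = n then mconst (W.inn (P n) (P n) ** B n) ** p n else 0)"
      unfolding T_def graded_mdegree[OF gP]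
      using P by (intro sum.cong) (auto simp: orthogonal_polys_def)
    then show ?thesis by simp
  qed
  then show ?thesis
    using that[of N] by (simp add: N B_def matrix_mul_assoc)
qed

section \<open>Direct sums of scalar weights\<close>

lemma scalar_dsum_nth_mult:
  "(scalar_dsum F ** A) $ j = (\<chi> s. F j $ 1 $ 1 * (A :: 'a::semiring_1 ^ 'k ^ 'n::finite) $ j $ s)"
proof -
  have "(\<Sum>k\<in>UNIV. scalar_dsum F $ j $ k * A $ k $ s) =
      (\<Sum>k\<in>UNIV. if k = j then F j $ 1 $ 1 * A $ j $ s else 0)" for s
    by (intro sum.cong) (auto simp: scalar_dsum_def)
  then show ?thesis
    by (simp add: matrix_matrix_mult_def vec_eq_iff)
qed

lemma scalar_dsum_mult:
  "scalar_dsum F ** scalar_dsum G = scalar_dsum (\<lambda>j. F j ** (G j :: 'a::semiring_1 ^ 1 ^ 1))"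
proof -
  have "(F j ** G j) $ 1 $ 1 = F j $ 1 $ 1 * G j $ 1 $ 1" for j
    by (simp add: matrix_matrix_mult_def sum_1)
  then have "(scalar_dsum F ** scalar_dsum G) $ j $ s = scalar_dsum (\<lambda>j. F j ** G j) $ j $ s" for j s
    by (simp add: scalar_dsum_nth_mult) (simp add: scalar_dsum_def)
  then show ?thesis by (simp add: vec_eq_iff)
qed

lemma scalar_dsum_mat_1: "scalar_dsum (\<lambda>j. mat 1) = mat 1"
  by (simp add: scalar_dsum_def mat_def vec_eq_iff)

lemma hconj_scalar_dsum: "hconj (scalar_dsum F) = scalar_dsum (\<lambda>j. hconj (F j))"
  by (simp add: scalar_dsum_def hconj_def vec_eq_iff)

lemma meval_scalar_dsum: "meval (scalar_dsum F) x = scalar_dsum (\<lambda>j. meval (F j) x)"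
  by (simp add: scalar_dsum_def meval_def vec_eq_iff)

lemma mcoeff_scalar_dsum: "mcoeff (scalar_dsum F) k = scalar_dsum (\<lambda>j. mcoeff (F j) k)"
  by (simp add: scalar_dsum_def mcoeff_def vec_eq_iff)

lemma scalar_dsum_0 [simp]: "scalar_dsum (\<lambda>j. 0) = 0"
  by (simp add: scalar_dsum_def vec_eq_iff)

lemma invertible_scalar_dsum:
  fixes F :: "'n::finite \<Rightarrow> 'a::semiring_1 ^ 1 ^ 1"
  assumes "\<And>j. invertible (F j)"
  shows "invertible (scalar_dsum F)"
proof -
  have "scalar_dsum F ** scalar_dsum (\<lambda>j. matrix_inv (F j)) = mat 1"
    "scalar_dsum (\<lambda>j. matrix_inv (F j)) ** scalar_dsum F = mat 1"
    using assms by (simp_all add: scalar_dsum_mult matrix_inv_left matrix_inv_right scalar_dsum_mat_1)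
  then show ?thesis
    unfolding invertible_def by blast
qed

text \<open>Writing each block as a column unit vector times \<open>F j\<close> times a row unit
  vector makes integrability and integrals of direct sums instances of
  \<open>bounded_linear_matrix_mult\<close>.\<close>

lemma scalar_dsum_eq_sum:
  fixes F :: "'n::finite \<Rightarrow> 'a::semiring_1 ^ 1 ^ 1"
  shows "scalar_dsum F =
    (\<Sum>j\<in>UNIV. (\<chi> r _. if r = j then 1 else 0) ** F j ** (\<chi> _ s. if s = j then 1 else 0))"
proof -
  have "((\<chi> r _. if r = j then 1 else 0) ** F j ** (\<chi> _ s. if s = j then 1 else 0)) $ r $ s =
      (if r = j then if s = j then F j $ 1 $ 1 else 0 else 0)" for r s j :: 'n
    by (simp add: matrix_matrix_mult_def sum_1)
  then show ?thesis
    by (auto simp: vec_eq_iff scalar_dsum_def)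
qed

text \<open>The quadratic form splits into one nonnegative term per coordinate, and a nonzero
  coordinate of \<open>v\<close> makes its term positive.\<close>

lemma pos_definite_scalar_dsum:
  fixes F :: "'n::finite \<Rightarrow> complex ^ 1 ^ 1"
  assumes "\<And>j. pos_definite (F j)"
  shows "pos_definite (scalar_dsum F)"
  unfolding pos_definite_def
proof (intro conjI allI impI)
  show "hconj (scalar_dsum F) = scalar_dsum F"
    using assms by (simp add: hconj_scalar_dsum pos_definite_def)
  fix v :: "complex ^ 'n" assume "v \<noteq> 0"
  then obtain j where j: "v $ j \<noteq> 0"
    by (auto simp: vec_eq_iff)
  have pos: "Re (cnj z * F i $ 1 $ 1 * z) > 0" if "z \<noteq> 0" for i z
  proof -
    have "(\<chi> _. z) \<noteq> (0 :: complex ^ 1)"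
      using that by (simp add: vec_eq_iff)
    with assms[of i] have "Re (\<Sum>i'\<in>UNIV. \<Sum>j'\<in>UNIV.
        cnj ((\<chi> _. z) $ i') * F i $ i' $ j' * (\<chi> _. z) $ j') > 0"
      unfolding pos_definite_def by blast
    then show ?thesis by (simp add: sum_1)
  qed
  have "Re (cnj (v $ i) * F i $ 1 $ 1 * v $ i) \<ge> 0" for i
    using pos[of "v $ i" i] by (cases "v $ i = 0") auto
  then have "0 < (\<Sum>i\<in>UNIV. Re (cnj (v $ i) * F i $ 1 $ 1 * v $ i))"
    using pos[OF j] by (intro sum_pos2[of _ j]) auto
  moreover have "(\<Sum>j\<in>UNIV. cnj (v $ i) * scalar_dsum F $ i $ j * v $ j) =
      (\<Sum>j\<in>UNIV. if j = i then cnj (v $ i) * F i $ 1 $ 1 * v $ i else 0)" for i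
    by (intro sum.cong) (auto simp: scalar_dsum_def)
  ultimately show "0 < Re (\<Sum>i\<in>UNIV. \<Sum>j\<in>UNIV. cnj (v $ i) * scalar_dsum F $ i $ j * v $ j)"
    by simp
qed

lemma moment_weight_scalar_dsum:
  assumes "\<And>j. moment_weight a b (w j)"
  shows "moment_weight a b (\<lambda>x. scalar_dsum (\<lambda>j. w j x))"
proof
  show "a < b"
    using assms by (rule moment_weight.less)
  have "AE x in lborel. \<forall>j. x \<in> einterval a b \<longrightarrow> pos_definite (w j x)"
    by (intro eventually_all_finite moment_weight.AE_pos_definite assms)
  then show "AE x in lborel. x \<in> einterval a b \<longrightarrow> pos_definite (scalar_dsum (\<lambda>j. w j x))"
    by (auto elim!: eventually_mono intro!: pos_definite_scalar_dsum)
  fix k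
  have "integrable lborel (\<lambda>x. \<Sum>j\<in>UNIV. (\<chi> r _. if r = j then 1 else 0) **
      (indicat_real (einterval a b) x *\<^sub>R x ^ k *\<^sub>R w j x) ** (\<chi> _ s. if s = j then 1 else 0))"
    by (intro Bochner_Integration.integrable_sum integrable_bounded_linear[OF bounded_linear_matrix_mult]
        moment_weight.moments[OF assms, unfolded set_integrable_def])
  then show "set_integrable lborel (einterval a b) (\<lambda>x. x ^ k *\<^sub>R scalar_dsum (\<lambda>j. w j x))"
    by (simp add: set_integrable_def scalar_dsum_eq_sum matrix_scaleR_left matrix_scaleR_right
        scaleR_sum_right del: scaleR_scaleR)
qed

lemma winner_scalar_dsum:
  assumes "\<And>j. moment_weight a b (w j)"
  shows "winner a b (\<lambda>x. scalar_dsum (\<lambda>j. w j x)) (scalar_dsum p) (scalar_dsum q) =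
    scalar_dsum (\<lambda>j. winner a b (w j) (p j) (q j))"
proof -
  define h where "h j x = indicat_real (einterval a b) x *\<^sub>R
    (meval (p j) x ** w j x ** hconj (meval (q j) x))" for j x
  have h: "integrable lborel (h j)" for j
    unfolding h_def using moment_weight.integrable_inn[OF assms] by (simp add: set_integrable_def)
  have "winner a b (\<lambda>x. scalar_dsum (\<lambda>j. w j x)) (scalar_dsum p) (scalar_dsum q) =
      (LBINT x. scalar_dsum (\<lambda>j. h j x))"
    unfolding winner_def set_lebesgue_integral_def
    by (intro Bochner_Integration.integral_cong refl)
      (simp add: meval_scalar_dsum hconj_scalar_dsum scalar_dsum_mult, simp add: scalar_dsum_def vec_eq_iff h_def)
  also have "\<dots> = (\<Sum>j\<in>UNIV. LBINT x. (\<chi> r _. if r = j then 1 else 0) **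
      h j x ** (\<chi> _ s. if s = j then 1 else 0))"
    unfolding scalar_dsum_eq_sum
    by (intro Bochner_Integration.integral_sum integrable_bounded_linear[OF bounded_linear_matrix_mult] h)
  also have "\<dots> = scalar_dsum (\<lambda>j. integral\<^sup>L lborel (h j))"
    unfolding scalar_dsum_eq_sum
    by (intro sum.cong refl integral_bounded_linear[OF bounded_linear_matrix_mult h])
  finally show ?thesis
    by (simp add: winner_def set_lebesgue_integral_def h_def[abs_def])
qed

lemma orthogonal_polys_scalar_dsum:
  fixes w :: "'n::finite \<Rightarrow> real \<Rightarrow> complex ^ 1 ^ 1"
  assumes "\<And>j. moment_weight a b (w j)" "\<And>j. orthogonal_polys a b (w j) (p j)"
  shows "orthogonal_polys a b (\<lambda>x. scalar_dsum (\<lambda>j. w j x)) (\<lambda>n. scalar_dsum (\<lambda>j. p j n))"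
  unfolding orthogonal_polys_def
proof (intro conjI allI impI)
  note graded = orthogonal_polys_graded[OF assms(2)]
  fix n
  show inv: "invertible (mcoeff (scalar_dsum (\<lambda>j. p j n)) n)"
    unfolding mcoeff_scalar_dsum by (intro invertible_scalar_dsum graded_invertible[OF graded])
  have "(mat 1 :: complex ^ 'n ^ 'n) \<noteq> 0"
    by (simp add: vec_eq_iff mat_def exI[of _ undefined])
  with inv have "mcoeff (scalar_dsum (\<lambda>j. p j n)) n \<noteq> 0"
    by (auto simp: invertible_def)
  moreover have "mdegree (scalar_dsum (\<lambda>j. p j n)) \<le> n"
    by (simp add: mdegree_le_iff mcoeff_scalar_dsum mcoeff_eq_0 graded_mdegree[OF graded])
  ultimately show "mdegree (scalar_dsum (\<lambda>j. p j n)) = n"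
    by (intro mdegree_eqI)
  fix m assume "n \<noteq> m"
  then show "winner a b (\<lambda>x. scalar_dsum (\<lambda>j. w j x)) (scalar_dsum (\<lambda>j. p j n)) (scalar_dsum (\<lambda>j. p j m)) = 0"
    using assms(2) by (simp add: winner_scalar_dsum[OF assms(1)] orthogonal_polys_def)
qed

section \<open>Operators and their rows\<close>

text \<open>A diagonal left factor scales each row separately, so row j of the coefficients of
  \<open>V\<close> sees only \<open>q j\<close>. The orders of \<open>V\<close> and
  \<open>D j\<close> may differ, whence the common bound \<open>d\<close>.\<close>

lemma act_scalar_dsum_row:
  fixes V :: "('n::finite, 'n) diffop" and D :: "'n \<Rightarrow> (1, 'n) diffop"
  assumes "\<And>i j. coeff V i $ j = coeff (D j) i $ 1"
  shows "act (scalar_dsum q) V $ j = act (q j) (D j) $ 1"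
proof -
  define d where "d = max (degree V) (degree (D j))"
  have "act (scalar_dsum q) V = (\<Sum>i\<le>d. (mderiv ^^ i) (scalar_dsum q) ** coeff V i)"
    "act (q j) (D j) = (\<Sum>i\<le>d. (mderiv ^^ i) (q j) ** coeff (D j) i)"
    by (simp_all add: act_ge d_def)
  moreover have "((mderiv ^^ i) (scalar_dsum q) ** coeff V i) $ j =
      ((mderiv ^^ i) (q j) ** coeff (D j) i) $ 1" for i
  proof -
    have "(mderiv ^^ i) (scalar_dsum q) = scalar_dsum (\<lambda>j. (mderiv ^^ i) (q j))"
      by (simp add: vec_eq_iff mderiv_pow_nth scalar_dsum_def)
    then show ?thesis
      by (simp add: scalar_dsum_nth_mult assms) (simp add: matrix_matrix_mult_def sum_1)
  qed
  ultimately show ?thesis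
    by simp
qed

lemma coeff_sum_monom: "coeff (\<Sum>i\<le>d. monom (F i) i) k = (if k \<le> d then F k else 0)"
  by (simp add: coeff_sum)

lemma diffop_of_rows:
  fixes D :: "'n::finite \<Rightarrow> (1, 'n) diffop"
  obtains V :: "('n, 'n) diffop" where "\<And>i j. coeff V i $ j = coeff (D j) i $ 1"
proof -
  define d where "d = Max (range (\<lambda>j. degree (D j)))"
  have "degree (D j) \<le> d" for j
    by (simp add: d_def)
  then have "coeff (D j) i = 0" if "\<not> i \<le> d" for i j
    using that by (intro coeff_eq_0) (meson le_less_linear order_le_less_trans)
  then have "coeff (\<Sum>i\<le>d. monom (\<chi> j. coeff (D j) i $ 1) i) i $ j = coeff (D j) i $ 1" for i j
    by (simp add: coeff_sum_monom)
  then show ?thesis by (rule that)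
qed

lemma rows_of_diffop:
  fixes V :: "('n::finite, 'n) diffop"
  obtains D :: "'n \<Rightarrow> (1, 'n) diffop" where "\<And>i j. coeff V i $ j = coeff (D j) i $ 1"
proof (rule that)
  show "coeff V i $ j = coeff (\<Sum>i\<le>degree V. monom (\<chi> _. coeff V i $ j) i) i $ 1" for i j
    by (simp add: coeff_sum_monom coeff_eq_0)
qed

lemma mconst_mult_row: "(mconst A ** P) $ j = (mconst (\<chi> _. A $ j) ** P) $ (1 :: 1)"
  by (simp add: mconst_def matrix_matrix_mult_def vec_eq_iff)

section \<open>Darboux factorizations and the criterion by rows\<close>

text \<open>The adjoint of \<open>V\<close> serves as the second factor \<open>N\<close>:
  \<open>V\<close> leads from \<open>p\<close> to \<open>P\<close> and \<open>N\<close> leads back,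
  so \<open>op_mult V N\<close> has every \<open>p n\<close> as an eigenfunction.\<close>

lemma darboux_transformation_if_invertible:
  fixes w W :: "real \<Rightarrow> complex ^ 'n ^ 'n::finite"
  assumes w: "moment_weight a b w" and W: "moment_weight a b W"
    and p: "orthogonal_polys a b w p" and P: "orthogonal_polys a b W P"
    and A: "\<And>n. act (p n) V = mconst (A n) ** P n" and "invertible (A m)"
  shows "darboux_transformation a b w p W P"
proof -
  note gp = orthogonal_polys_graded[OF p] and gP = orthogonal_polys_graded[OF P]
  obtain N where N: "\<And>n. act (P n) N = mconst (winner a b W (P n) (P n) **
      hconj (A n) ** matrix_inv (winner a b w (p n) (p n))) ** p n" (is "\<And>n. _ = mconst (?B n) ** _")
    using adjoint_diffop[OF w W p P A] by blast
  have inv_A: "\<forall>\<^sub>\<infinity>n. invertible (A n)"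
    by (rule MOST_invertible[OF gp gP A assms(6)])
  \<comment> \<open>The norms of \<open>p n\<close> and \<open>P n\<close> are invertible, so
    \<open>N\<close> inherits invertibility for almost all n from \<open>V\<close>.\<close>
  have inv_B: "invertible (?B n)" if "invertible (A n)" for n
    by (intro invertible_mult invertible_matrix_inv invertible_hconj that
        moment_weight.invertible_inn[OF w graded_invertible[OF gp]]
        moment_weight.invertible_inn[OF W graded_invertible[OF gP]])
  have "degree_preserving V"
    by (rule degree_preserving_if_invertible[OF gp gP A inv_A])
  moreover have "degree_preserving N"
    by (rule degree_preserving_if_invertible[OF gP gp N MOST_mono[OF inv_A inv_B]])
  moreover have "act (p n) (op_mult V N) = mconst (A n ** ?B n) ** p n" for n
    by (simp add: act_op_mult A left_linear_mconst[OF left_linear_act] N mconst_mult)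
  then have "op_mult V N \<in> diffop_algebra a b w"
    unfolding diffop_algebra_def using p by blast
  ultimately show ?thesis
    unfolding darboux_transformation_def using p P A by blast
qed

theorem theorem4p3:
  fixes a b :: ereal
    and W :: "real \<Rightarrow> complex ^ 'n ^ 'n::finite"
    and P :: "nat \<Rightarrow> ('n, 'n) mpoly"
    and w :: "'n \<Rightarrow> real \<Rightarrow> complex ^ 1 ^ 1"
    and p :: "'n \<Rightarrow> nat \<Rightarrow> (1, 1) mpoly"
  assumes "a < b"
    and "weight_matrix a b W" and "\<And>j. weight_matrix a b (w j)"
    and "good_enough a b W" and "\<And>j. good_enough a b (w j)"
    and "good_enough a b (\<lambda>x. scalar_dsum (\<lambda>j. w j x))"
    and "good_enough a b (\<lambda>x. block_dsum (W x) (scalar_dsum (\<lambda>j. w j x)))"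
    and "orthogonal_polys a b W P" and "\<And>j. orthogonal_polys a b (w j) (p j)"
  shows "darboux_transformation a b
           (\<lambda>x. scalar_dsum (\<lambda>j. w j x)) (\<lambda>n. scalar_dsum (\<lambda>j. p j n)) W P
     \<longleftrightarrow> (\<exists>(D :: 'n \<Rightarrow> (1, 'n) diffop) (\<Lambda> :: 'n \<Rightarrow> nat \<Rightarrow> complex ^ 'n ^ 1).
            (\<forall>j n. mconst (\<Lambda> j n) ** P n = act (p j n) (D j)) \<and>
            (\<exists>n. inj (\<lambda>j. \<Lambda> j n $ 1) \<and> vec.independent (range (\<lambda>j. \<Lambda> j n $ 1))))"
    (is "?darboux \<longleftrightarrow> ?rows")
proof
  have w: "moment_weight a b (w j)" for j
    using assms(1,3) by unfold_locales (simp_all add: weight_matrix_def)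
  have W: "moment_weight a b W"
    using assms(1,2) by unfold_locales (simp_all add: weight_matrix_def)
  note p = orthogonal_polys_scalar_dsum[of a b w p, OF w assms(9)]
  show ?rows if darboux: ?darboux
  proof -
    obtain V A where V: "degree_preserving V"
      and A: "\<And>n. act (scalar_dsum (\<lambda>j. p j n)) V = mconst (A n) ** P n"
      using darboux unfolding darboux_transformation_def by blast
    obtain D :: "'n \<Rightarrow> (1, 'n) diffop" where D: "\<And>i j. coeff V i $ j = coeff (D j) i $ 1"
      using rows_of_diffop by blast
    \<comment> \<open>Reading the matrix identity for \<open>V\<close> row by row makes the vectors
      for \<open>D j\<close> the rows of \<open>A n\<close>.\<close>
    define \<Lambda> :: "'n \<Rightarrow> nat \<Rightarrow> complex ^ 'n ^ 1" where "\<Lambda> j n = (\<chi> _. A n $ j)" for j n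
    have "(mconst (\<Lambda> j n) ** P n) $ 1 = act (p j n) (D j) $ 1" for j n
      unfolding act_scalar_dsum_row[OF D, of "\<lambda>j. p j n" j, symmetric] A \<Lambda>_def
      by (rule mconst_mult_row[symmetric])
    then have "mconst (\<Lambda> j n) ** P n = act (p j n) (D j)" for j n
      by (subst vec_eq_iff) (simp add: forall_1)
    \<comment> \<open>Invertibility for almost all n supplies the single index that is asked
      for.\<close>
    moreover obtain n where "invertible (A n)"
      using invertible_if_degree_preserving[OF orthogonal_polys_graded[OF p] A V]
      by (auto simp: MOST_nat)
    then have "inj (\<lambda>j. \<Lambda> j n $ 1) \<and> vec.independent (range (\<lambda>j. \<Lambda> j n $ 1))"
      by (simp add: invertible_iff_independent_rows \<Lambda>_def)
    ultimately show ?thesis by blast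
  qed
  show ?darboux if rows: ?rows
  proof -
    obtain D \<Lambda> m where eq: "\<And>j n. mconst (\<Lambda> j n) ** P n = act (p j n) (D j)"
      and ind: "inj (\<lambda>j. \<Lambda> j m $ 1)" "vec.independent (range (\<lambda>j. \<Lambda> j m $ 1))"
      using rows by blast
    obtain V :: "('n, 'n) diffop" where V: "\<And>i j. coeff V i $ j = coeff (D j) i $ 1"
      using diffop_of_rows by blast
    \<comment> \<open>Conversely, the vectors at n are stacked as rows; their independence at
      \<open>m\<close> makes \<open>A m\<close> invertible.\<close>
    define A :: "nat \<Rightarrow> complex ^ 'n ^ 'n" where "A n = (\<chi> j. \<Lambda> j n $ 1)" for n
    have "act (scalar_dsum (\<lambda>j. p j n)) V $ j = (mconst (A n) ** P n) $ j" for n j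
    proof -
      have "(\<chi> _. A n $ j) = \<Lambda> j n"
        by (subst vec_eq_iff) (simp add: A_def forall_1)
      then show ?thesis
        by (simp add: act_scalar_dsum_row[OF V] mconst_mult_row[of "A n" "P n" j] eq)
    qed
    then have "act (scalar_dsum (\<lambda>j. p j n)) V = mconst (A n) ** P n" for n
      by (subst vec_eq_iff) blast
    moreover have "(\<lambda>j. \<Lambda> j m $ 1) = ($) (A m)"
      by (simp add: A_def fun_eq_iff)
    then have "invertible (A m)"
      using ind by (simp only: invertible_iff_independent_rows simp_thms)
    ultimately show ?thesis
      by (rule darboux_transformation_if_invertible[OF moment_weight_scalar_dsum[OF w] W p assms(8)])
  qed
qed

end
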